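(* Let $G$ and $H$ be torsion free finitely presented groups, and suppose that $G$ is quasi isometric to $H$. Then $G$ admits a strongly aperiodic subshift of finite type if and only if $H$ does.
   Context: For a finite set $A$ and a group $G$, $G$ acts on the right on $A^G$ (product topology, $A$ discrete) by $(\sigma\cdot h)(g)=\sigma(hg)$. A subshift is a closed $G$-invariant subset of $A^G$. A subshift of finite type is a set of the form $X=\bigcap_{g\in G}(C\cdot g)$, where $C=\{\sigma\in A^G:\sigma|_S\in L\}$ for some finite subset $S\subset G$ and some $L\subset A^S$. A nonempty subshift $X\subset A^G$ is strongly aperiodic if every $\sigma\in X$ has trivial stabilizer in $G$. "$G$ admits a strongly aperiodic subshift of finite type" means that for some finite set $A$ there is a (nonempty) strongly aperiodic subshift of finite type $X\subset A^G$. A map $f:X\to Y$ of metric spaces is an $n$-quasi isometric embedding if $\frac{d(x_1,x_2)}{n}-n\le d(f(x_1),f(x_2))\le n\,d(x_1,x_2)+n$ for all $x_1,x_2\in X$, and $n$-quasi surjective if the $n$-neighborhood of $f(X)$ is all of $Y$; it is a quasi isometry if for some $n$ it is both. Finitely generated groups are quasi isometric if their Cayley graphs (with respect to finite generating sets, each edge having length $1$) are quasi isometric. *)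

theory Defs
  imports "HOL-Analysis.Analysis" "HOL-Algebra.Generated_Groups"
begin

section \<open>Subshifts\<close>

text \<open>Configurations over a group \<open>G\<close> with alphabet \<open>A\<close> are the extensional functions in
  \<open>carrier G \<rightarrow>\<^sub>E A\<close>, which is the underlying set of the product topology below.\<close>

definition shift :: "('a, 'c) monoid_scheme \<Rightarrow> ('a \<Rightarrow> 's) \<Rightarrow> 'a \<Rightarrow> ('a \<Rightarrow> 's)" where
  "shift G \<sigma> h = (\<lambda>g\<in>carrier G. \<sigma> (h \<otimes>\<^bsub>G\<^esub> g))"

definition subshift :: "('a, 'c) monoid_scheme \<Rightarrow> 's set \<Rightarrow> ('a \<Rightarrow> 's) set \<Rightarrow> bool" where
  "subshift G A X \<longleftrightarrow>
     closedin (product_topology (\<lambda>_. discrete_topology A) (carrier G)) X \<and>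
     (\<forall>\<sigma>\<in>X. \<forall>h\<in>carrier G. shift G \<sigma> h \<in> X)"

definition subshift_of_finite_type ::
    "('a, 'c) monoid_scheme \<Rightarrow> 's set \<Rightarrow> ('a \<Rightarrow> 's) set \<Rightarrow> bool" where
  "subshift_of_finite_type G A X \<longleftrightarrow>
     (\<exists>S L. finite S \<and> S \<subseteq> carrier G \<and> L \<subseteq> (S \<rightarrow>\<^sub>E A) \<and>
        X = (\<Inter>g\<in>carrier G.
               (\<lambda>\<sigma>. shift G \<sigma> g) ` {\<sigma> \<in> carrier G \<rightarrow>\<^sub>E A. restrict \<sigma> S \<in> L}))"

definition strongly_aperiodic ::
    "('a, 'c) monoid_scheme \<Rightarrow> 's set \<Rightarrow> ('a \<Rightarrow> 's) set \<Rightarrow> bool" where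
  "strongly_aperiodic G A X \<longleftrightarrow>
     subshift G A X \<and> X \<noteq> {} \<and> (\<forall>\<sigma>\<in>X. {h \<in> carrier G. shift G \<sigma> h = \<sigma>} = {\<one>\<^bsub>G\<^esub>})"

text \<open>Only the cardinality of the alphabet matters, so finite sets of natural numbers
  represent all finite alphabets; HOL cannot quantify over the alphabet type here.\<close>

definition admits_strongly_aperiodic_SFT :: "('a, 'c) monoid_scheme \<Rightarrow> bool" where
  "admits_strongly_aperiodic_SFT G \<longleftrightarrow>
     (\<exists>(A :: nat set) X. finite A \<and> subshift_of_finite_type G A X \<and> strongly_aperiodic G A X)"


section \<open>Torsion-free and finitely presented groups\<close>

definition torsion_free_group :: "('a, 'c) monoid_scheme \<Rightarrow> bool" where
  "torsion_free_group G \<longleftrightarrow>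
     (\<forall>x\<in>carrier G. \<forall>n>0. x [^]\<^bsub>G\<^esub> (n::nat) = \<one>\<^bsub>G\<^esub> \<longrightarrow> x = \<one>\<^bsub>G\<^esub>)"

text \<open>The letters \<open>(x, True)\<close> and \<open>(x, False)\<close> stand for the generator \<open>x\<close> and its formal
  inverse. The group presented by generators \<open>X\<close> and relators \<open>R\<close> is the set of words in these
  letters modulo insertion and deletion of mutually inverse adjacent letters and of relators,
  with concatenation as multiplication.\<close>

definition group_words :: "'x set \<Rightarrow> ('x \<times> bool) list set" where
  "group_words X = lists (X \<times> UNIV)"

inductive_set presentation_rel ::
    "'x set \<Rightarrow> ('x \<times> bool) list set \<Rightarrow> (('x \<times> bool) list \<times> ('x \<times> bool) list) set"
  for X :: "'x set" and R :: "('x \<times> bool) list set"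
where
  rel_refl: "w \<in> group_words X \<Longrightarrow> (w, w) \<in> presentation_rel X R"
| rel_sym: "(v, w) \<in> presentation_rel X R \<Longrightarrow> (w, v) \<in> presentation_rel X R"
| rel_trans: "\<lbrakk>(u, v) \<in> presentation_rel X R; (v, w) \<in> presentation_rel X R\<rbrakk>
    \<Longrightarrow> (u, w) \<in> presentation_rel X R"
| rel_cancel: "\<lbrakk>u \<in> group_words X; v \<in> group_words X; x \<in> X\<rbrakk>
    \<Longrightarrow> (u @ [(x, b), (x, \<not> b)] @ v, u @ v) \<in> presentation_rel X R"
| rel_relator: "\<lbrakk>u \<in> group_words X; v \<in> group_words X; r \<in> R\<rbrakk>
    \<Longrightarrow> (u @ r @ v, u @ v) \<in> presentation_rel X R"

definition presented_group ::
    "'x set \<Rightarrow> ('x \<times> bool) list set \<Rightarrow> ('x \<times> bool) list set monoid" where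
  "presented_group X R =
     \<lparr>carrier = group_words X // presentation_rel X R,
      mult = (\<lambda>A B. \<Union>a\<in>A. \<Union>b\<in>B. presentation_rel X R `` {a @ b}),
      one = presentation_rel X R `` {[]}\<rparr>"

definition finitely_presented :: "('a, 'c) monoid_scheme \<Rightarrow> bool" where
  "finitely_presented G \<longleftrightarrow>
     (\<exists>(n::nat) R. finite R \<and> R \<subseteq> group_words {..<n} \<and> G \<cong> presented_group {..<n} R)"

lemma group_words_append [simp]:
  "u @ v \<in> group_words X \<longleftrightarrow> u \<in> group_words X \<and> v \<in> group_words X"
  by (simp add: group_words_def)

lemma group_words_Nil [simp]: "[] \<in> group_words X"
  by (simp add: group_words_def)

lemma group_words_Cons [simp]:
  "(x, b) # w \<in> group_words X \<longleftrightarrow> x \<in> X \<and> w \<in> group_words X"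
  by (auto simp: group_words_def)

lemma presentation_rel_words:
  assumes "R \<subseteq> group_words X" "(v, w) \<in> presentation_rel X R"
  shows "v \<in> group_words X \<and> w \<in> group_words X"
  using assms(2,1) by induction auto

lemma equiv_presentation_rel:
  assumes "R \<subseteq> group_words X"
  shows "equiv (group_words X) (presentation_rel X R)"
  using presentation_rel_words[OF assms]
  by (intro equivI)
     (auto simp: refl_on_def sym_on_def trans_on_def
       intro: rel_refl rel_sym rel_trans)

lemma presentation_rel_context:
  assumes "(v, w) \<in> presentation_rel X R" "p \<in> group_words X" "q \<in> group_words X"
  shows "(p @ v @ q, p @ w @ q) \<in> presentation_rel X R"
  using assms
proof induction
  case (rel_cancel u v x b)
  then show ?case using presentation_rel.rel_cancel[of "p @ u" X "v @ q" x b R] by simp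
next
  case (rel_relator u v r)
  then show ?case using presentation_rel.rel_relator[of "p @ u" X "v @ q" r R] by simp
next
  case (rel_trans u v w)
  then show ?case by (meson presentation_rel.rel_trans)
qed (simp_all add: rel_refl rel_sym)

lemma presentation_rel_append:
  assumes R: "R \<subseteq> group_words X"
    and "(a, a') \<in> presentation_rel X R" "(b, b') \<in> presentation_rel X R"
  shows "(a @ b, a' @ b') \<in> presentation_rel X R"
proof -
  have "(a @ b, a' @ b) \<in> presentation_rel X R"
    using presentation_rel_context[OF assms(2), of "[]" b] presentation_rel_words[OF R assms(3)]
    by simp
  moreover have "(a' @ b, a' @ b') \<in> presentation_rel X R"
    using presentation_rel_context[OF assms(3), of a' "[]"] presentation_rel_words[OF R assms(2)]
    by simp
  ultimately show ?thesis by (rule rel_trans)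
qed

lemma presented_group_mult:
  assumes R: "R \<subseteq> group_words X" and "a \<in> group_words X" "b \<in> group_words X"
  shows "presentation_rel X R `` {a} \<otimes>\<^bsub>presented_group X R\<^esub> presentation_rel X R `` {b}
    = presentation_rel X R `` {a @ b}"
proof -
  have "congruent2 (presentation_rel X R) (presentation_rel X R)
          (\<lambda>a b. presentation_rel X R `` {a @ b})"
    using equiv_class_eq[OF equiv_presentation_rel[OF R]] presentation_rel_append[OF R]
    by (intro congruent2I') blast
  from UN_equiv_class2[OF equiv_presentation_rel[OF R] equiv_presentation_rel[OF R] this assms(2,3)]
  show ?thesis by (simp add: presented_group_def)
qed

lemma presentation_rel_inverse:
  assumes "w \<in> group_words X"
  shows "(rev (map (apsnd Not) w) @ w, []) \<in> presentation_rel X R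
    \<and> rev (map (apsnd Not) w) \<in> group_words X"
  using assms
proof (induction w)
  case Nil
  then show ?case by (simp add: rel_refl)
next
  case (Cons l w)
  obtain x b where l: "l = (x, b)" by fastforce
  show ?case
    using Cons rel_cancel[of "rev (map (apsnd Not) w)" X w x "\<not> b" R]
    by (auto simp: l intro: rel_trans)
qed

lemma group_presented_group:
  assumes R: "R \<subseteq> group_words X"
  shows "group (presented_group X R)"
proof (rule groupI)
  let ?P = "presented_group X R" and ?c = "\<lambda>w. presentation_rel X R `` {w}"
  have carr: "carrier ?P = ?c ` group_words X" and one: "\<one>\<^bsub>?P\<^esub> = ?c []"
    by (auto simp: presented_group_def quotient_def)
  note mult = presented_group_mult[OF R]
  show "x \<otimes>\<^bsub>?P\<^esub> y \<in> carrier ?P" if "x \<in> carrier ?P" "y \<in> carrier ?P" for x y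
    using that by (auto simp: carr mult)
  show "\<one>\<^bsub>?P\<^esub> \<in> carrier ?P" by (auto simp: carr one)
  show "x \<otimes>\<^bsub>?P\<^esub> y \<otimes>\<^bsub>?P\<^esub> z = x \<otimes>\<^bsub>?P\<^esub> (y \<otimes>\<^bsub>?P\<^esub> z)"
    if "x \<in> carrier ?P" "y \<in> carrier ?P" "z \<in> carrier ?P" for x y z
    using that by (auto simp: carr mult)
  show "\<one>\<^bsub>?P\<^esub> \<otimes>\<^bsub>?P\<^esub> x = x" if "x \<in> carrier ?P" for x
    using that by (auto simp: carr one mult)
  show "\<exists>y\<in>carrier ?P. y \<otimes>\<^bsub>?P\<^esub> x = \<one>\<^bsub>?P\<^esub>" if "x \<in> carrier ?P" for x
  proof -
    from that obtain w where w: "w \<in> group_words X" "x = ?c w" by (auto simp: carr)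
    note inv = presentation_rel_inverse[OF w(1), of R]
    have "?c (rev (map (apsnd Not) w)) \<otimes>\<^bsub>?P\<^esub> x = \<one>\<^bsub>?P\<^esub>"
      using inv w equiv_class_eq[OF equiv_presentation_rel[OF R]] by (simp add: mult one)
    then show ?thesis using inv by (auto simp: carr)
  qed
qed


section \<open>Cayley graphs as metric spaces\<close>

text \<open>A graph is given by its vertex set \<open>V\<close> and its set \<open>E\<close> of two-element edges. Points of its
  geometric realization are written in barycentric coordinates: a point is supported either on
  one vertex or on the two endpoints of an edge.\<close>

definition graph_cells :: "'v set \<Rightarrow> 'v set set \<Rightarrow> 'v set set" where
  "graph_cells V E = {{v} | v. v \<in> V} \<union> E"

definition graph_realization :: "'v set \<Rightarrow> 'v set set \<Rightarrow> ('v \<Rightarrow> real) set" where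
  "graph_realization V E =
     {p. (\<forall>v. 0 \<le> p v) \<and> {v. p v \<noteq> 0} \<in> graph_cells V E \<and> (\<Sum>v | p v \<noteq> 0. p v) = 1}"

definition in_common_cell :: "'v set \<Rightarrow> 'v set set \<Rightarrow> ('v \<Rightarrow> real) \<Rightarrow> ('v \<Rightarrow> real) \<Rightarrow> bool" where
  "in_common_cell V E p q \<longleftrightarrow> (\<exists>c\<in>graph_cells V E. {v. p v \<noteq> 0} \<union> {v. q v \<noteq> 0} \<subseteq> c)"

text \<open>The points \<open>(1 - s) u + s v\<close> and \<open>(1 - t) u + t v\<close> of an edge with endpoints \<open>u\<close> and \<open>v\<close>
  differ by \<open>\<bar>s - t\<bar>\<close> in both nonzero coordinates. The factor 1/2 therefore gives each edge
  length 1.\<close>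

definition segment_length :: "('v \<Rightarrow> real) \<Rightarrow> ('v \<Rightarrow> real) \<Rightarrow> real" where
  "segment_length p q = (\<Sum>v | p v \<noteq> 0 \<or> q v \<noteq> 0. \<bar>p v - q v\<bar>) / 2"

fun chain_length :: "('v \<Rightarrow> real) list \<Rightarrow> real" where
  "chain_length (p # q # ps) = segment_length p q + chain_length (q # ps)"
| "chain_length _ = 0"

definition graph_chain ::
    "'v set \<Rightarrow> 'v set set \<Rightarrow> ('v \<Rightarrow> real) \<Rightarrow> ('v \<Rightarrow> real) \<Rightarrow> ('v \<Rightarrow> real) list \<Rightarrow> bool" where
  "graph_chain V E p q ps \<longleftrightarrow>
     ps \<noteq> [] \<and> hd ps = p \<and> last ps = q \<and> set ps \<subseteq> graph_realization V E \<and>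
     successively (in_common_cell V E) ps"

text \<open>The length metric: the infimum of the lengths of piecewise linear paths. The value 0 off the
  realization is only for compatibility with the locale \<^locale>\<open>Metric_space\<close>.\<close>

definition graph_dist ::
    "'v set \<Rightarrow> 'v set set \<Rightarrow> ('v \<Rightarrow> real) \<Rightarrow> ('v \<Rightarrow> real) \<Rightarrow> real" where
  "graph_dist V E p q =
     (if p \<in> graph_realization V E \<and> q \<in> graph_realization V E
      then Inf (chain_length ` {ps. graph_chain V E p q ps}) else 0)"

lemma finite_support_graph_realization:
  "p \<in> graph_realization V E \<Longrightarrow> finite {v. p v \<noteq> 0}"
  unfolding graph_realization_def by (auto intro: ccontr)

lemma segment_length_superset:
  assumes "finite F" "{v. p v \<noteq> 0} \<subseteq> F" "{v. q v \<noteq> 0} \<subseteq> F"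
  shows "segment_length p q = (\<Sum>v\<in>F. \<bar>p v - q v\<bar>) / 2"
  unfolding segment_length_def using assms by (auto intro!: sum.mono_neutral_left)

lemma segment_length_nonneg: "0 \<le> segment_length p q"
  by (simp add: segment_length_def sum_nonneg)

lemma segment_length_commute: "segment_length p q = segment_length q p"
  by (simp add: segment_length_def abs_minus_commute disj_commute)

lemma segment_length_refl [simp]: "segment_length p p = 0"
  by (simp add: segment_length_def)

lemma segment_length_triangle:
  assumes "p \<in> graph_realization V E" "q \<in> graph_realization V E" "r \<in> graph_realization V E"
  shows "segment_length p r \<le> segment_length p q + segment_length q r"
proof -
  let ?F = "{v. p v \<noteq> 0} \<union> {v. q v \<noteq> 0} \<union> {v. r v \<noteq> 0}"
  have F: "finite ?F" using assms by (simp add: finite_support_graph_realization)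
  have "(\<Sum>v\<in>?F. \<bar>p v - r v\<bar>) \<le> (\<Sum>v\<in>?F. \<bar>p v - q v\<bar> + \<bar>q v - r v\<bar>)"
    by (intro sum_mono) linarith
  moreover have "segment_length p r = (\<Sum>v\<in>?F. \<bar>p v - r v\<bar>) / 2"
    "segment_length p q = (\<Sum>v\<in>?F. \<bar>p v - q v\<bar>) / 2"
    "segment_length q r = (\<Sum>v\<in>?F. \<bar>q v - r v\<bar>) / 2"
    by (rule segment_length_superset[OF F]; blast)+
  ultimately show ?thesis by (simp add: sum.distrib)
qed

lemma segment_length_eq_0:
  assumes "p \<in> graph_realization V E" "q \<in> graph_realization V E" "segment_length p q = 0"
  shows "p = q"
proof
  fix v
  have "finite {v. p v \<noteq> 0 \<or> q v \<noteq> 0}"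
    unfolding Collect_disj_eq using assms by (simp add: finite_support_graph_realization)
  with assms(3) show "p v = q v"
    by (cases "p v = 0 \<and> q v = 0") (auto simp: segment_length_def sum_nonneg_eq_0_iff)
qed

lemma chain_length_nonneg: "0 \<le> chain_length ps"
  by (induction ps rule: chain_length.induct) (auto simp: segment_length_nonneg)

lemma chain_length_join:
  "chain_length (ps @ p # qs) = chain_length (ps @ [p]) + chain_length (p # qs)"
  by (induction ps rule: chain_length.induct) auto

lemma chain_length_rev: "chain_length (rev ps) = chain_length ps"
proof (induction ps rule: chain_length.induct)
  case (1 p q ps)
  then show ?case
    using chain_length_join[of "rev ps" q "[p]"] by (simp add: segment_length_commute)
qed auto

lemma segment_length_le_chain_length:
  "ps \<noteq> [] \<Longrightarrow> set ps \<subseteq> graph_realization V E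
    \<Longrightarrow> segment_length (hd ps) (last ps) \<le> chain_length ps"
proof (induction ps rule: chain_length.induct)
  case (1 p q ps)
  have "last (q # ps) \<in> graph_realization V E"
    using 1(3) last_in_set[of "q # ps"] by auto
  then show ?case
    using 1 segment_length_triangle[of p V E q "last (q # ps)"] by force
qed auto

lemma graph_chain_rev:
  assumes "graph_chain V E p q ps"
  shows "graph_chain V E q p (rev ps)"
proof -
  have "in_common_cell V E y x" if "in_common_cell V E x y" for x y
    using that by (simp only: in_common_cell_def Un_commute)
  then have "successively (\<lambda>x y. in_common_cell V E y x) ps"
    using assms unfolding graph_chain_def by (elim conjE successively_mono) simp
  then show ?thesis
    using assms by (simp add: graph_chain_def hd_rev last_rev)
qed

lemma graph_chain_join:
  assumes "graph_chain V E p q ps" "graph_chain V E q r qs"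
  shows "graph_chain V E p r (ps @ tl qs)
    \<and> chain_length (ps @ tl qs) = chain_length ps + chain_length qs"
proof -
  obtain ps' where ps: "ps = ps' @ [q]"
    using assms(1) unfolding graph_chain_def by (metis append_butlast_last_id)
  obtain qs' where qs: "qs = q # qs'"
    using assms(2) unfolding graph_chain_def by (metis list.collapse)
  have "successively (in_common_cell V E) (ps' @ q # qs')"
    using assms by (cases qs') (simp_all add: ps qs graph_chain_def successively_append_iff)
  moreover have "hd (ps' @ q # qs') = p" "last (ps' @ q # qs') = r"
    "set (ps' @ q # qs') \<subseteq> graph_realization V E"
    using assms by (cases ps'; simp add: ps qs graph_chain_def)+
  ultimately show ?thesis
    using chain_length_join[of ps' q qs'] by (simp add: ps qs graph_chain_def)
qed

lemma Metric_space_graph: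
  assumes conn: "\<And>p q. \<lbrakk>p \<in> graph_realization V E; q \<in> graph_realization V E\<rbrakk>
    \<Longrightarrow> \<exists>ps. graph_chain V E p q ps"
  shows "Metric_space (graph_realization V E) (graph_dist V E)"
proof
  let ?P = "graph_realization V E"
  let ?L = "\<lambda>p q. chain_length ` {ps. graph_chain V E p q ps}"
  have bdd: "bdd_below (?L p q)" for p q
    by (rule bdd_belowI[of _ 0]) (auto simp: chain_length_nonneg)
  have ne: "?L p q \<noteq> {}" if "p \<in> ?P" "q \<in> ?P" for p q
    using conn[OF that] by auto
  have le: "segment_length p q \<le> graph_dist V E p q" if "p \<in> ?P" "q \<in> ?P" for p q
  proof -
    have "segment_length p q \<le> x" if "x \<in> ?L p q" for x
      using that segment_length_le_chain_length by (fastforce simp: graph_chain_def)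
    then show ?thesis using that ne[OF that] by (simp add: graph_dist_def cInf_greatest)
  qed
  show "0 \<le> graph_dist V E p q" for p q
  proof (cases "p \<in> ?P \<and> q \<in> ?P")
    case True
    then show ?thesis using le segment_length_nonneg order_trans by blast
  qed (auto simp: graph_dist_def)
  have "?L p q \<subseteq> ?L q p" for p q
  proof
    fix x assume "x \<in> ?L p q"
    then obtain ps where "x = chain_length ps" "graph_chain V E p q ps" by blast
    then have "x = chain_length (rev ps)" "graph_chain V E q p (rev ps)"
      by (simp_all add: chain_length_rev graph_chain_rev)
    then show "x \<in> ?L q p" by blast
  qed
  then have "?L p q = ?L q p" for p q by blast
  then show "graph_dist V E p q = graph_dist V E q p" for p q
    by (simp add: graph_dist_def)
  show "graph_dist V E p q = 0 \<longleftrightarrow> p = q" if "p \<in> ?P" "q \<in> ?P" for p q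
  proof
    assume "graph_dist V E p q = 0"
    then have "segment_length p q = 0"
      using le[OF that] segment_length_nonneg[of p q] by simp
    then show "p = q" using segment_length_eq_0 that by blast
  next
    assume "p = q"
    then have "graph_chain V E p q [p]" using that by (simp add: graph_chain_def)
    then have "0 \<in> ?L p q" by force
    then have "graph_dist V E p q \<le> 0"
      using that cInf_lower[OF _ bdd] by (auto simp: graph_dist_def)
    then show "graph_dist V E p q = 0"
      using le[OF that] segment_length_nonneg[of p q] by simp
  qed
  show "graph_dist V E p r \<le> graph_dist V E p q + graph_dist V E q r"
    if "p \<in> ?P" "q \<in> ?P" "r \<in> ?P" for p q r
  proof -
    have "Inf (?L p r) \<le> a + b" if ab: "a \<in> ?L p q" "b \<in> ?L q r" for a b
    proof -
      from ab obtain ps qs where "graph_chain V E p q ps" "a = chain_length ps"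
        "graph_chain V E q r qs" "b = chain_length qs" by blast
      then have "a + b \<in> ?L p r"
        using graph_chain_join[of V E p q ps r qs] by (intro image_eqI[of _ _ "ps @ tl qs"]) auto
      then show ?thesis by (intro cInf_lower bdd)
    qed
    then have "Inf (?L p r) - b \<le> Inf (?L p q)" if "b \<in> ?L q r" for b
      using that \<open>p \<in> ?P\<close> \<open>q \<in> ?P\<close> by (intro cInf_greatest ne) (auto simp: algebra_simps)
    then have "Inf (?L p r) - Inf (?L p q) \<le> Inf (?L q r)"
      using \<open>q \<in> ?P\<close> \<open>r \<in> ?P\<close> by (intro cInf_greatest ne) (auto simp: algebra_simps)
    then show ?thesis using that by (simp add: graph_dist_def)
  qed
qed

definition generates :: "('a, 'c) monoid_scheme \<Rightarrow> 'a set \<Rightarrow> bool" where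
  "generates G S \<longleftrightarrow> S \<subseteq> carrier G \<and> generate G S = carrier G"

text \<open>The Cayley graph is taken as a simple graph: the identity is skipped, so there are no loops,
  and parallel edges are identified.\<close>

definition cayley_edges :: "('a, 'c) monoid_scheme \<Rightarrow> 'a set \<Rightarrow> 'a set set" where
  "cayley_edges G S = {{g, g \<otimes>\<^bsub>G\<^esub> s} | g s. g \<in> carrier G \<and> s \<in> S \<and> s \<noteq> \<one>\<^bsub>G\<^esub>}"

definition cayley_space :: "('a, 'c) monoid_scheme \<Rightarrow> 'a set \<Rightarrow> ('a \<Rightarrow> real) set" where
  "cayley_space G S = graph_realization (carrier G) (cayley_edges G S)"

definition cayley_dist ::
    "('a, 'c) monoid_scheme \<Rightarrow> 'a set \<Rightarrow> ('a \<Rightarrow> real) \<Rightarrow> ('a \<Rightarrow> real) \<Rightarrow> real" where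
  "cayley_dist G S = graph_dist (carrier G) (cayley_edges G S)"

lemma cayley_connected:
  assumes "group G" and S: "generates G S"
    and p: "p \<in> cayley_space G S" and q: "q \<in> cayley_space G S"
  shows "\<exists>ps. graph_chain (carrier G) (cayley_edges G S) p q ps"
proof -
  interpret group G by fact
  let ?V = "carrier G" and ?E = "cayley_edges G S"
  define C where "C p q \<longleftrightarrow> (\<exists>ps. graph_chain ?V ?E p q ps)" for p q
  define pt where "pt g = (\<lambda>v. of_bool (v = g) :: real)" for g :: 'a
  have supp: "{v. pt g v \<noteq> 0} = {g}" for g by (auto simp: pt_def)
  have pt: "pt g \<in> graph_realization ?V ?E" if "g \<in> ?V" for g
    using that unfolding graph_realization_def mem_Collect_eq supp
    by (auto simp: pt_def graph_cells_def)
  have trans: "C p q \<Longrightarrow> C q r \<Longrightarrow> C p r" for p q r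
    unfolding C_def by (elim exE, rule exI, rule conjunct1[OF graph_chain_join])
  have sym: "C p q \<Longrightarrow> C q p" for p q
    unfolding C_def by (elim exE, rule exI, rule graph_chain_rev)
  have step: "C p q" if "p \<in> graph_realization ?V ?E" "q \<in> graph_realization ?V ?E"
    "in_common_cell ?V ?E p q" for p q
    unfolding C_def using that by (intro exI[of _ "[p, q]"]) (simp add: graph_chain_def)
  have mult_gen: "C (pt g) (pt (g \<otimes>\<^bsub>G\<^esub> s))" if "g \<in> ?V" "s \<in> S" for g s
  proof (cases "s = \<one>\<^bsub>G\<^esub>")
    case True
    then show ?thesis
      using that pt[OF that(1)] step[of "pt g" "pt g"]
      by (auto simp: in_common_cell_def supp graph_cells_def)
  next
    case False
    then have "{g, g \<otimes>\<^bsub>G\<^esub> s} \<in> graph_cells ?V ?E"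
      using that by (auto simp: graph_cells_def cayley_edges_def)
    then have "in_common_cell ?V ?E (pt g) (pt (g \<otimes>\<^bsub>G\<^esub> s))"
      unfolding in_common_cell_def supp by (rule bexI[rotated]) simp
    moreover have "s \<in> ?V" using that S by (auto simp: generates_def)
    ultimately show ?thesis using that by (intro step pt m_closed)
  qed
  have mult: "h \<in> ?V \<and> (\<forall>g\<in>?V. C (pt g) (pt (g \<otimes>\<^bsub>G\<^esub> h)))" if "h \<in> generate G S" for h
    using that
  proof induction
    case one
    have "C (pt g) (pt g)" if "g \<in> ?V" for g
      unfolding C_def using pt[OF that] by (intro exI[of _ "[pt g]"]) (simp add: graph_chain_def)
    then show ?case by simp
  next
    case (incl h)
    then show ?case using mult_gen S by (auto simp: generates_def)
  next
    case (inv h)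
    then have h: "h \<in> ?V" using S by (auto simp: generates_def)
    have "C (pt g) (pt (g \<otimes>\<^bsub>G\<^esub> inv\<^bsub>G\<^esub> h))" if "g \<in> ?V" for g
      using mult_gen[of "g \<otimes>\<^bsub>G\<^esub> inv\<^bsub>G\<^esub> h" h] that h inv by (simp add: m_assoc sym)
    with h show ?case by simp
  next
    case (eng h1 h2)
    have "C (pt g) (pt (g \<otimes>\<^bsub>G\<^esub> (h1 \<otimes>\<^bsub>G\<^esub> h2)))" if "g \<in> ?V" for g
    proof (rule trans)
      show "C (pt g) (pt (g \<otimes>\<^bsub>G\<^esub> h1))" using eng that by blast
      show "C (pt (g \<otimes>\<^bsub>G\<^esub> h1)) (pt (g \<otimes>\<^bsub>G\<^esub> (h1 \<otimes>\<^bsub>G\<^esub> h2)))"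
        using eng.IH bspec[of ?V _ "g \<otimes>\<^bsub>G\<^esub> h1"] that by (simp add: m_assoc[symmetric])
    qed
    with eng show ?case by simp
  qed
  have vertices: "C (pt g) (pt h)" if "g \<in> ?V" "h \<in> ?V" for g h
  proof -
    have "inv\<^bsub>G\<^esub> g \<otimes>\<^bsub>G\<^esub> h \<in> generate G S" using S that by (simp add: generates_def)
    from mult[OF this] have "C (pt g) (pt (g \<otimes>\<^bsub>G\<^esub> (inv\<^bsub>G\<^esub> g \<otimes>\<^bsub>G\<^esub> h)))" using that by blast
    then show ?thesis using that by (simp add: m_assoc[symmetric])
  qed
  have near: "\<exists>g\<in>?V. C p (pt g)" if "p \<in> graph_realization ?V ?E" for p
  proof -
    have cell: "{v. p v \<noteq> 0} \<in> graph_cells ?V ?E"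
      using that by (simp add: graph_realization_def)
    then obtain g where g: "g \<in> {v. p v \<noteq> 0}" "g \<in> ?V"
      unfolding graph_cells_def cayley_edges_def by blast
    then have "in_common_cell ?V ?E p (pt g)"
      unfolding in_common_cell_def supp using cell by (intro bexI[of _ "{v. p v \<noteq> 0}"]) auto
    then have "C p (pt g)" by (intro step that pt g)
    with g show ?thesis by blast
  qed
  obtain g where g: "g \<in> ?V" "C p (pt g)"
    using near[of p] p unfolding cayley_space_def by blast
  obtain h where h: "h \<in> ?V" "C q (pt h)"
    using near[of q] q unfolding cayley_space_def by blast
  have "C p q"
    using trans[OF trans[OF g(2) vertices[OF g(1) h(1)]] sym[OF h(2)]] .
  then show ?thesis by (simp add: C_def)
qed

lemma Metric_space_cayley:
  assumes "group G" "generates G S"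
  shows "Metric_space (cayley_space G S) (cayley_dist G S)"
  using Metric_space_graph[OF cayley_connected[OF assms]]
  by (simp add: cayley_space_def cayley_dist_def)


section \<open>Quasi-isometry\<close>

definition quasi_isometric_embedding ::
    "nat \<Rightarrow> 'm set \<Rightarrow> ('m \<Rightarrow> 'm \<Rightarrow> real) \<Rightarrow> 'n set \<Rightarrow> ('n \<Rightarrow> 'n \<Rightarrow> real) \<Rightarrow> ('m \<Rightarrow> 'n) \<Rightarrow> bool" where
  "quasi_isometric_embedding n X dX Y dY f \<longleftrightarrow>
     f \<in> X \<rightarrow> Y \<and>
     (\<forall>x1\<in>X. \<forall>x2\<in>X. dX x1 x2 / real n - real n \<le> dY (f x1) (f x2) \<and>
                      dY (f x1) (f x2) \<le> real n * dX x1 x2 + real n)"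

definition quasi_surjective ::
    "nat \<Rightarrow> 'm set \<Rightarrow> 'n set \<Rightarrow> ('n \<Rightarrow> 'n \<Rightarrow> real) \<Rightarrow> ('m \<Rightarrow> 'n) \<Rightarrow> bool" where
  "quasi_surjective n X Y dY f \<longleftrightarrow> (\<forall>y\<in>Y. \<exists>x\<in>X. dY (f x) y \<le> real n)"

text \<open>The constant must be positive, since it is a divisor.\<close>

definition quasi_isometry ::
    "'m set \<Rightarrow> ('m \<Rightarrow> 'm \<Rightarrow> real) \<Rightarrow> 'n set \<Rightarrow> ('n \<Rightarrow> 'n \<Rightarrow> real) \<Rightarrow> ('m \<Rightarrow> 'n) \<Rightarrow> bool" where
  "quasi_isometry X dX Y dY f \<longleftrightarrow>
     (\<exists>n>0. quasi_isometric_embedding n X dX Y dY f \<and> quasi_surjective n X Y dY f)"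

definition quasi_isometric_groups ::
    "('a, 'c) monoid_scheme \<Rightarrow> ('b, 'd) monoid_scheme \<Rightarrow> bool" where
  "quasi_isometric_groups G H \<longleftrightarrow>
     (\<exists>S T. finite S \<and> generates G S \<and> finite T \<and> generates H T \<and>
        (\<exists>f. quasi_isometry (cayley_space G S) (cayley_dist G S)
                            (cayley_space H T) (cayley_dist H T) f))"

end

theory Submission
  imports Defs
begin

text \<open>A quasi-isometry between the Cayley graphs gives maps \<open>\<phi>0\<close> from \<open>H\<close> to \<open>G\<close> and back that preserve,
  in both directions, lying at a bounded distance. Given a subshift of finite type \<open>\<Xi>\<close> on \<open>G\<close>, take on \<open>H\<close> all
  configurations that on every ball of radius \<open>N\<close> look like a translate of the following one, for some \<open>x\<close>
  in \<open>\<Xi>\<close>: the symbol at \<open>h\<close> consists of the increments of \<open>\<phi>0\<close> along the generators at \<open>h\<close> and of the part of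
  \<open>x\<close> near \<open>\<phi>0 h\<close>.

  Since \<open>H\<close> is finitely presented, for large \<open>N\<close> the increments integrate to a map \<open>\<phi>\<close> from \<open>H\<close> to \<open>G\<close> that
  agrees with a translate of \<open>\<phi>0\<close> on each ball. Paths in \<open>G\<close> lift along \<open>\<phi>\<close> uniquely up to bounded error, so
  \<open>\<phi>\<close> is a coarse covering; as \<open>G\<close> is finitely presented, there is no monodromy, and \<open>\<phi>\<close> is coarsely onto with
  fibres of bounded diameter. Hence the local parts glue to a configuration \<open>x\<close> in \<open>\<Xi>\<close>. An element \<open>h\<close> that
  stabilizes the configuration on \<open>H\<close> satisfies \<open>\<phi> (h k) = \<phi> h \<phi> k\<close>, and \<open>\<phi> h\<close> stabilizes \<open>x\<close>, so \<open>\<phi> h = 1\<close> by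
  aperiodicity. Then all powers of \<open>h\<close> lie in one bounded fibre of \<open>\<phi>\<close>, and torsion-freeness gives \<open>h = 1\<close>.\<close>

section \<open>Finite presentations\<close>

lemma (in group) mult_inv_cancel: "\<lbrakk>x \<in> carrier G; y \<in> carrier G\<rbrakk> \<Longrightarrow> x \<otimes> (inv x \<otimes> y) = y"
  by (simp add: m_assoc[symmetric])

lemma (in group) inv_mult_cancel: "\<lbrakk>x \<in> carrier G; y \<in> carrier G\<rbrakk> \<Longrightarrow> inv x \<otimes> (x \<otimes> y) = y"
  by (simp add: m_assoc[symmetric])

text \<open>Universal property of a presentation, up to an equivalence: letters acting on
  \<open>E\<close> modulo \<open>Q\<close>, with cancelling pairs and relators acting trivially,
  induce an action of the presented group. It serves once for path lifting over \<open>G\<close> and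
  once, with equality as \<open>Q\<close>, for integration along words in \<open>H\<close>.\<close>

lemma foldl_presentation_rel:
  assumes rel: "(v, w) \<in> presentation_rel X R" and R: "R \<subseteq> group_words X"
    and closed: "\<And>e x b. e \<in> E \<Longrightarrow> x \<in> X \<Longrightarrow> act e (x, b) \<in> E"
    and equiv: "equiv E Q"
    and cong: "\<And>e e' x b. (e, e') \<in> Q \<Longrightarrow> x \<in> X \<Longrightarrow> (act e (x, b), act e' (x, b)) \<in> Q"
    and cancel: "\<And>e x b. e \<in> E \<Longrightarrow> x \<in> X \<Longrightarrow> (act (act e (x, b)) (x, \<not> b), e) \<in> Q"
    and relator: "\<And>e r. e \<in> E \<Longrightarrow> r \<in> R \<Longrightarrow> (foldl act e r, e) \<in> Q"
    and e: "e \<in> E"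
  shows "(foldl act e v, foldl act e w) \<in> Q"
proof -
  have closed': "foldl act e w \<in> E" if "w \<in> group_words X" "e \<in> E" for w e
    using that by (induction w arbitrary: e) (auto simp: closed)
  have cong': "(foldl act e w, foldl act e' w) \<in> Q" if "w \<in> group_words X" "(e, e') \<in> Q" for w e e'
    using that by (induction w arbitrary: e e') (auto simp: cong)
  show ?thesis
    using rel e
  proof (induction arbitrary: e)
    case (rel_refl w)
    then show ?case using closed' equiv by (meson equivE refl_onD)
  next
    case (rel_sym v w)
    then show ?case using equiv by (meson equivE symD)
  next
    case (rel_trans u v w)
    then show ?case using equiv by (meson equivE transD)
  next
    case (rel_cancel u v x b)
    then show ?case using closed'[of u e] by (simp add: cong' cancel)
  next
    case (rel_relator u v r)
    then show ?case using closed'[of u e] by (simp add: cong' relator)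
  qed
qed

text \<open>An evaluation of words replaces the isomorphism with \<open>presented_group\<close>;
  \<open>ev_eq_iff\<close> says that all relations are consequences of \<open>R\<close>.\<close>

locale group_presentation = group G for G (structure) +
  fixes X :: "'x set" and R :: "('x \<times> bool) list set" and ev :: "('x \<times> bool) list \<Rightarrow> 'a"
  assumes finite_generators: "finite X" and finite_relators: "finite R"
    and relators_words: "R \<subseteq> group_words X"
    and ev_closed [simp, intro]: "w \<in> group_words X \<Longrightarrow> ev w \<in> carrier G"
    and ev_append: "\<lbrakk>v \<in> group_words X; w \<in> group_words X\<rbrakk> \<Longrightarrow> ev (v @ w) = ev v \<otimes> ev w"
    and ev_surj: "g \<in> carrier G \<Longrightarrow> \<exists>w\<in>group_words X. ev w = g"
    and ev_eq_iff: "\<lbrakk>v \<in> group_words X; w \<in> group_words X\<rbrakk>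
      \<Longrightarrow> ev v = ev w \<longleftrightarrow> (v, w) \<in> presentation_rel X R"
begin

lemma ev_Nil [simp]: "ev [] = \<one>"
  using ev_append[of "[]" "[]"] ev_closed[of "[]"] by (simp del: ev_closed)

lemma ev_Cons: "x \<in> X \<Longrightarrow> w \<in> group_words X \<Longrightarrow> ev ((x, b) # w) = ev [(x, b)] \<otimes> ev w"
  using ev_append[of "[(x, b)]" w] by simp

lemma ev_relator: "r \<in> R \<Longrightarrow> ev r = \<one>"
  using ev_eq_iff[of r "[]"] relators_words rel_relator[of "[]" X "[]" r R] by auto

lemma ev_cancel: "x \<in> X \<Longrightarrow> ev [(x, b)] \<otimes> ev [(x, \<not> b)] = \<one>"
  using ev_eq_iff[of "[(x, b), (x, \<not> b)]" "[]"] rel_cancel[of "[]" X "[]" x b R]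
    ev_append[of "[(x, b)]" "[(x, \<not> b)]"] by simp

text \<open>The ball about the identity in the word metric. Throughout,
  \<open>inv g \<otimes> h \<in> wball n\<close> expresses that \<open>g\<close> and
  \<open>h\<close> have word distance at most \<open>n\<close>.\<close>

definition wball :: "nat \<Rightarrow> 'a set" where
  "wball n = ev ` {w \<in> group_words X. length w \<le> n}"

lemma wball_closed [simp, intro]: "u \<in> wball n \<Longrightarrow> u \<in> carrier G"
  by (auto simp: wball_def)

lemma finite_wball: "finite (wball n)"
proof -
  have "finite (X \<times> (UNIV :: bool set))" using finite_generators by simp
  from finite_lists_length_le[OF this, of n] show ?thesis
    by (auto simp: wball_def group_words_def lists_eq_set conj_commute)
qed

lemma wball_mono: "u \<in> wball m \<Longrightarrow> m \<le> n \<Longrightarrow> u \<in> wball n"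
  by (auto simp: wball_def)

lemma one_in_wball [simp]: "\<one> \<in> wball n"
  unfolding wball_def by (rule image_eqI[of _ _ "[]"]) auto

lemma letter_in_wball: "x \<in> X \<Longrightarrow> ev [(x, b)] \<in> wball 1"
  unfolding wball_def by (rule image_eqI[of _ _ "[(x, b)]"]) auto

lemma wball_mult: "u \<in> wball m \<Longrightarrow> v \<in> wball n \<Longrightarrow> u \<otimes> v \<in> wball (m + n)"
  unfolding wball_def by (force simp: ev_append[symmetric])

lemma inv_in_wball: "u \<in> wball n \<Longrightarrow> inv u \<in> wball n"
proof -
  assume "u \<in> wball n"
  then obtain w where w: "w \<in> group_words X" "length w \<le> n" "u = ev w"
    by (auto simp: wball_def)
  let ?v = "rev (map (apsnd Not) w)"
  have v: "(?v @ w, []) \<in> presentation_rel X R" "?v \<in> group_words X"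
    using presentation_rel_inverse[OF w(1), of R] by auto
  then have "ev ?v \<otimes> u = \<one>"
    using w ev_eq_iff[of "?v @ w" "[]"] by (simp add: ev_append)
  then have "inv u = ev ?v" using w v inv_equality by blast
  then show ?thesis using v w by (auto simp: wball_def)
qed

lemma wball_dist_trans:
  assumes "h \<in> carrier G" "h' \<in> carrier G" "h'' \<in> carrier G"
    and "inv h \<otimes> h' \<in> wball i" "inv h' \<otimes> h'' \<in> wball j"
  shows "inv h \<otimes> h'' \<in> wball (i + j)"
proof -
  have "h' \<otimes> (inv h' \<otimes> h'') = h''" using assms(1-3) by (simp add: m_assoc[symmetric])
  then have "(inv h \<otimes> h') \<otimes> (inv h' \<otimes> h'') = inv h \<otimes> h''"
    using assms(1-3) by (simp add: m_assoc)
  then show ?thesis using wball_mult[OF assms(4,5)] by simp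
qed

lemma wball_dist_sym:
  assumes "h \<in> carrier G" "h' \<in> carrier G" "inv h \<otimes> h' \<in> wball i"
  shows "inv h' \<otimes> h \<in> wball i"
  using inv_in_wball[OF assms(3)] assms(1,2) by (simp add: inv_mult_group)

text \<open>Turns the finite sets supplied by a coarse equivalence into radii.\<close>

lemma finite_subset_wball:
  assumes "finite F" "F \<subseteq> carrier G"
  shows "\<exists>n. F \<subseteq> wball n"
  using assms
proof induction
  case (insert g F)
  then obtain n where n: "F \<subseteq> wball n" by auto
  obtain w where "w \<in> group_words X" "ev w = g" using insert ev_surj by blast
  then have "g \<in> wball (max n (length w))" by (auto simp: wball_def)
  moreover have "F \<subseteq> wball (max n (length w))" using n wball_mono by (meson max.cobounded1 subset_iff)
  ultimately show ?case by blast
qed auto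

end

lemma finitely_presented_presentation:
  assumes "group G" "finitely_presented G"
  shows "\<exists>(X :: nat set) R ev. group_presentation G X R ev"
proof -
  interpret group G by fact
  obtain n :: nat and R where R: "finite R" "R \<subseteq> group_words {..<n}"
    and "G \<cong> presented_group {..<n} R"
    using assms by (auto simp: finitely_presented_def)
  then obtain f where f: "f \<in> iso G (presented_group {..<n} R)" by (auto simp: is_iso_def)
  let ?X = "{..<n}" and ?P = "presented_group {..<n} R"
  let ?c = "\<lambda>w. presentation_rel ?X R `` {w}"
  interpret P: group ?P by (rule group_presented_group[OF R(2)])
  have bij: "bij_betw f (carrier G) (carrier ?P)" and hom: "f \<in> hom G ?P"
    using f by (auto simp: iso_def)
  have carr: "carrier ?P = ?c ` group_words ?X" by (auto simp: presented_group_def quotient_def)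
  define ev where "ev w = inv_into (carrier G) f (?c w)" for w
  have ev: "ev w \<in> carrier G" "f (ev w) = ?c w" if "w \<in> group_words ?X" for w
  proof -
    have "?c w \<in> f ` carrier G" using that bij carr by (auto simp: bij_betw_def)
    then show "ev w \<in> carrier G" "f (ev w) = ?c w"
      unfolding ev_def by (rule inv_into_into f_inv_into_f; assumption)+
  qed
  have inj: "g = h" if "f g = f h" "g \<in> carrier G" "h \<in> carrier G" for g h
    using bij that by (meson bij_betw_imp_inj_on inj_onD)
  have "group_presentation G ?X R ev"
  proof unfold_locales
    show "ev (v @ w) = ev v \<otimes>\<^bsub>G\<^esub> ev w"
      if "v \<in> group_words ?X" "w \<in> group_words ?X" for v w
      using that hom by (intro inj) (auto simp: ev hom_mult presented_group_mult[OF R(2)])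
    show "\<exists>w\<in>group_words ?X. ev w = g" if "g \<in> carrier G" for g
    proof -
      have "f g \<in> carrier ?P" using that hom by (rule hom_in_carrier[rotated])
      then obtain w where "w \<in> group_words ?X" "f g = ?c w" unfolding carr by blast
      then show ?thesis using that by (metis ev inj)
    qed
    show "ev v = ev w \<longleftrightarrow> (v, w) \<in> presentation_rel ?X R"
      if "v \<in> group_words ?X" "w \<in> group_words ?X" for v w
      using that eq_equiv_class_iff[OF equiv_presentation_rel[OF R(2)]] ev inj by metis
  qed (use R ev in auto)
  then show ?thesis by blast
qed

section \<open>Coarse coverings\<close>

text \<open>The set \<open>F\<close> absorbs the failure of \<open>\<phi>\<close> to be onto,
  \<open>m\<close> bounds the error of a lift, and \<open>N\<close> is the scale at which
  injectivity is known. Lifting a word \<open>w\<close> drifts by at most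
  \<open>m * length w\<close> in \<open>H\<close>, so the assumptions on \<open>N\<close> keep the
  lifts of relators, of images of generators and of elements of \<open>F\<close> within reach of
  \<open>locally_injective\<close>.\<close>

locale coarse_covering =
  H: group_presentation H Y Q evH + G: group_presentation G X R ev
  for H :: "('b, 'd) monoid_scheme" and Y :: "'y set" and Q evH
    and G :: "('a, 'c) monoid_scheme" and X :: "'x set" and R ev +
  fixes \<phi> :: "'b \<Rightarrow> 'a" and F :: "'a set" and m N :: nat
  assumes \<phi>_closed [simp]: "h \<in> carrier H \<Longrightarrow> \<phi> h \<in> carrier G"
    and F: "F \<subseteq> carrier G" "\<one>\<^bsub>G\<^esub> \<in> F"
    and N_ge: "3 * m \<le> N" "r \<in> R \<Longrightarrow> m * length r \<le> N"
    and locally_injective: "\<lbrakk>h \<in> carrier H; u \<in> H.wball N; a \<in> F; a' \<in> F;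
      \<phi> h \<otimes>\<^bsub>G\<^esub> a = \<phi> (h \<otimes>\<^bsub>H\<^esub> u) \<otimes>\<^bsub>G\<^esub> a'\<rbrakk> \<Longrightarrow> u \<in> H.wball m"
    and path_lifting: "\<lbrakk>h \<in> carrier H; a \<in> F; x \<in> X\<rbrakk>
      \<Longrightarrow> \<exists>u\<in>H.wball m. \<exists>a'\<in>F. \<phi> h \<otimes>\<^bsub>G\<^esub> a \<otimes>\<^bsub>G\<^esub> ev [(x, b)] = \<phi> (h \<otimes>\<^bsub>H\<^esub> u) \<otimes>\<^bsub>G\<^esub> a'"
    and short_steps: "\<lbrakk>h \<in> carrier H; y \<in> Y\<rbrakk>
      \<Longrightarrow> \<exists>w\<in>group_words X. m * length w + 1 \<le> N \<and> \<phi> (h \<otimes>\<^bsub>H\<^esub> evH [(y, b)]) = \<phi> h \<otimes>\<^bsub>G\<^esub> ev w"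
    and short_F: "a \<in> F \<Longrightarrow> \<exists>w\<in>group_words X. m * length w + 1 \<le> N \<and> ev w = a"
begin

text \<open>A state \<open>(g, h)\<close> records that \<open>h\<close> lies over \<open>g\<close>, up to the error \<open>F\<close>. Modulo \<open>near\<close> the states
  form a covering of \<open>G\<close>, on which \<open>G\<close> acts by path lifting because its relators are short.\<close>

definition states :: "('a \<times> 'b) set" where
  "states = {(g, h). h \<in> carrier H \<and> (\<exists>a\<in>F. g = \<phi> h \<otimes>\<^bsub>G\<^esub> a)}"

definition near :: "(('a \<times> 'b) \<times> ('a \<times> 'b)) set" where
  "near = {(e, e'). e \<in> states \<and> e' \<in> states \<and> fst e = fst e'
     \<and> inv\<^bsub>H\<^esub> (snd e) \<otimes>\<^bsub>H\<^esub> snd e' \<in> H.wball m}"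

text \<open>Any lift within distance \<open>m\<close> may be chosen: two candidates are at distance
  at most \<open>m + m \<le> N\<close>, hence related by \<open>near\<close>.\<close>

definition move :: "'a \<times> 'b \<Rightarrow> 'x \<times> bool \<Rightarrow> 'a \<times> 'b" where
  "move e l = (let g = fst e \<otimes>\<^bsub>G\<^esub> ev [l]
     in (g, snd e \<otimes>\<^bsub>H\<^esub> (SOME u. u \<in> H.wball m \<and> (g, snd e \<otimes>\<^bsub>H\<^esub> u) \<in> states)))"

lemma states_closed: "e \<in> states \<Longrightarrow> fst e \<in> carrier G \<and> snd e \<in> carrier H"
  using F by (auto simp: states_def)

lemma move:
  assumes e: "e \<in> states" and x: "x \<in> X"
  shows "move e (x, b) \<in> states" "fst (move e (x, b)) = fst e \<otimes>\<^bsub>G\<^esub> ev [(x, b)]"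
    "inv\<^bsub>H\<^esub> (snd e) \<otimes>\<^bsub>H\<^esub> snd (move e (x, b)) \<in> H.wball m"
proof -
  obtain g h where gh: "e = (g, h)" by fastforce
  let ?g = "g \<otimes>\<^bsub>G\<^esub> ev [(x, b)]"
  let ?P = "\<lambda>u. u \<in> H.wball m \<and> (?g, h \<otimes>\<^bsub>H\<^esub> u) \<in> states"
  from e gh obtain a where "h \<in> carrier H" "a \<in> F" "g = \<phi> h \<otimes>\<^bsub>G\<^esub> a" by (auto simp: states_def)
  moreover from path_lifting[OF this(1,2) x, of b]
  obtain u a' where "u \<in> H.wball m" "a' \<in> F" "?g = \<phi> (h \<otimes>\<^bsub>H\<^esub> u) \<otimes>\<^bsub>G\<^esub> a'"
    using \<open>g = _\<close> by auto
  ultimately have "\<exists>u. ?P u" by (auto simp: states_def)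
  define u where "u = (SOME u. ?P u)"
  have u: "?P u" unfolding u_def by (rule someI_ex) fact
  have mv: "move e (x, b) = (?g, h \<otimes>\<^bsub>H\<^esub> u)" by (simp add: move_def gh Let_def u_def)
  show "move e (x, b) \<in> states" "fst (move e (x, b)) = fst e \<otimes>\<^bsub>G\<^esub> ev [(x, b)]"
    using u by (auto simp: mv[unfolded gh] gh)
  show "inv\<^bsub>H\<^esub> (snd e) \<otimes>\<^bsub>H\<^esub> snd (move e (x, b)) \<in> H.wball m"
    using u H.wball_closed[of u m] \<open>h \<in> carrier H\<close> by (simp add: mv[unfolded gh] gh H.m_assoc[symmetric])
qed

text \<open>Local injectivity improves a distance of at most \<open>N\<close> to one of at most
  \<open>m\<close>. This gain keeps errors from accumulating.\<close>

lemma nearI: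
  assumes "e \<in> states" "e' \<in> states" "fst e = fst e'"
    and "inv\<^bsub>H\<^esub> (snd e) \<otimes>\<^bsub>H\<^esub> snd e' \<in> H.wball N"
  shows "(e, e') \<in> near"
proof -
  obtain g h h' where gh: "e = (g, h)" "e' = (g, h')" using assms(3) by (metis prod.collapse)
  obtain a a' where *: "h \<in> carrier H" "h' \<in> carrier H" "a \<in> F" "a' \<in> F"
    "g = \<phi> h \<otimes>\<^bsub>G\<^esub> a" "g = \<phi> h' \<otimes>\<^bsub>G\<^esub> a'"
    using assms(1,2) by (auto simp: states_def gh)
  moreover have "h \<otimes>\<^bsub>H\<^esub> (inv\<^bsub>H\<^esub> h \<otimes>\<^bsub>H\<^esub> h') = h'" using * by (simp add: H.m_assoc[symmetric])
  ultimately have "inv\<^bsub>H\<^esub> h \<otimes>\<^bsub>H\<^esub> h' \<in> H.wball m"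
    using locally_injective[of h "inv\<^bsub>H\<^esub> h \<otimes>\<^bsub>H\<^esub> h'" a a'] assms(4) gh by simp
  then show ?thesis using assms gh by (simp add: near_def)
qed

lemma nearD:
  assumes "(e, e') \<in> near"
  shows "e \<in> states" "e' \<in> states" "fst e = fst e'" "inv\<^bsub>H\<^esub> (snd e) \<otimes>\<^bsub>H\<^esub> snd e' \<in> H.wball m"
  using assms by (auto simp: near_def)

lemma equiv_near: "equiv states near"
proof (rule equivI)
  show "near \<subseteq> states \<times> states" by (auto simp: near_def)
  show "refl_on states near"
    using states_closed by (auto simp: refl_on_def near_def)
  show "sym near"
    using states_closed H.wball_dist_sym by (auto simp: sym_def near_def)
  show "trans near"
  proof (rule transI)
    fix e e' e'' assume "(e, e') \<in> near" "(e', e'') \<in> near"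
    \<comment> \<open>The two distances add up to \<open>m + m\<close>, which is at most
      \<open>N\<close>; \<open>nearI\<close> then restores the bound \<open>m\<close>.\<close>
    note * = nearD[OF this(1)] nearD[OF this(2)]
    have "inv\<^bsub>H\<^esub> (snd e) \<otimes>\<^bsub>H\<^esub> snd e'' \<in> H.wball (m + m)"
      using * states_closed by (intro H.wball_dist_trans[of _ "snd e'"]) auto
    then show "(e, e'') \<in> near"
      using * N_ge(1) H.wball_mono[of _ "m + m" N] by (intro nearI) auto
  qed
qed

lemma near_refl: "e \<in> states \<Longrightarrow> (e, e) \<in> near"
  using equiv_near by (meson equivE refl_onD)

lemma near_sym: "(e, e') \<in> near \<Longrightarrow> (e', e) \<in> near"
  using equiv_near by (meson equivE symD)

lemma near_trans: "(e, e') \<in> near \<Longrightarrow> (e', e'') \<in> near \<Longrightarrow> (e, e'') \<in> near"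
  using equiv_near by (meson equivE transD)

text \<open>The new states are joined by three displacements of size at most \<open>m\<close>: back
  along one lift, across the old gap, and forward along the other lift. Hence the requirement
  \<open>3 * m \<le> N\<close>.\<close>

lemma move_near:
  assumes "(e, e') \<in> near" and x: "x \<in> X"
  shows "(move e (x, b), move e' (x, b)) \<in> near"
proof (rule nearI)
  note e = nearD[OF assms(1)]
  note moves = move[OF e(1) x] move[OF e(2) x]
  show "move e (x, b) \<in> states" "move e' (x, b) \<in> states" using moves by auto
  show "fst (move e (x, b)) = fst (move e' (x, b))" using moves e by simp
  have "inv\<^bsub>H\<^esub> (snd (move e (x, b))) \<otimes>\<^bsub>H\<^esub> snd (move e' (x, b)) \<in> H.wball (m + m + m)"
    using moves e states_closed
    by (intro H.wball_dist_trans[of _ "snd e'"] H.wball_dist_trans[of _ "snd e"] H.wball_dist_sym[of "snd e"]) auto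
  then show "inv\<^bsub>H\<^esub> (snd (move e (x, b))) \<otimes>\<^bsub>H\<^esub> snd (move e' (x, b)) \<in> H.wball N"
    using N_ge(1) H.wball_mono[of _ "m + m + m" N] by simp
qed

section \<open>Lifting words through the covering\<close>

lemma moves:
  assumes "e \<in> states" "w \<in> group_words X"
  shows "foldl move e w \<in> states \<and> fst (foldl move e w) = fst e \<otimes>\<^bsub>G\<^esub> ev w
    \<and> inv\<^bsub>H\<^esub> (snd e) \<otimes>\<^bsub>H\<^esub> snd (foldl move e w) \<in> H.wball (m * length w)"
  using assms
proof (induction w arbitrary: e)
  case Nil
  then show ?case using states_closed by simp
next
  case (Cons l w)
  obtain x b where l: "l = (x, b)" by fastforce
  have x: "x \<in> X" "w \<in> group_words X" using Cons by (auto simp: l)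
  note e' = move[OF Cons(2) x(1), of b]
  note IH = Cons.IH[OF e'(1) x(2)]
  have "inv\<^bsub>H\<^esub> (snd e) \<otimes>\<^bsub>H\<^esub> snd (foldl move (move e l) w) \<in> H.wball (m + m * length w)"
    using IH e' Cons(2) states_closed unfolding l
    by (intro H.wball_dist_trans[of _ "snd (move e (x, b))"]) auto
  then show ?case
    using IH e' states_closed[OF Cons(2)] x by (simp add: l G.ev_Cons[OF x] G.m_assoc)
qed

lemma moves_near:
  "\<lbrakk>w \<in> group_words X; (e, e') \<in> near\<rbrakk> \<Longrightarrow> (foldl move e w, foldl move e' w) \<in> near"
proof (induction w arbitrary: e e')
  case (Cons l w)
  then show ?case using move_near[OF Cons(3)] by (cases l) auto
qed auto

text \<open>Lifts of short loops close up: the end lies over the start and has drifted by at most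
  \<open>N\<close>, so \<open>nearI\<close> applies.\<close>

lemma moves_back:
  assumes "e \<in> states" "w \<in> group_words X" "ev w = \<one>\<^bsub>G\<^esub>" "m * length w \<le> N"
  shows "(foldl move e w, e) \<in> near"
  using moves[OF assms(1,2)] states_closed[OF assms(1)] assms H.wball_mono
  by (intro near_sym[OF nearI]) auto

text \<open>Absence of monodromy. Relations of \<open>G\<close> are consequences of its relators,
  and these are short enough for \<open>moves_back\<close>.\<close>

lemma moves_eq:
  assumes "e \<in> states" "v \<in> group_words X" "w \<in> group_words X" "ev v = ev w"
  shows "(foldl move e v, foldl move e w) \<in> near"
proof (rule foldl_presentation_rel[OF _ G.relators_words _ equiv_near _ _ _ assms(1)])
  show "(v, w) \<in> presentation_rel X R" using assms G.ev_eq_iff by blast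
  show "(move (move e (x, b)) (x, \<not> b), e) \<in> near" if "e \<in> states" "x \<in> X" for e x b
    using moves_back[OF that(1), of "[(x, b), (x, \<not> b)]"] that N_ge(1)
      G.ev_append[of "[(x, b)]" "[(x, \<not> b)]"] G.ev_cancel by simp
  show "(foldl move e r, e) \<in> near" if "e \<in> states" "r \<in> R" for e r
    using moves_back[OF that(1), of r] that N_ge(2) G.relators_words G.ev_relator by auto
qed (auto simp: move move_near)

section \<open>Connectedness and the number of sheets\<close>

lemma base_state: "h \<in> carrier H \<Longrightarrow> (\<phi> h, h) \<in> states"
  using F by (auto simp: states_def intro!: bexI[of _ "\<one>\<^bsub>G\<^esub>"])

text \<open>A path in \<open>H\<close> from \<open>h\<close> to \<open>h'\<close> is followed letter
  by letter; over each letter \<open>\<phi>\<close> changes by a short word of \<open>G\<close>,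
  whose lift must end near the next point of the path.\<close>

lemma base_states_connected:
  assumes h: "h \<in> carrier H" and "h' \<in> carrier H"
  shows "\<exists>w\<in>group_words X. (foldl move (\<phi> h, h) w, (\<phi> h', h')) \<in> near"
proof -
  have "\<exists>w\<in>group_words X. (foldl move (\<phi> h, h) w, (\<phi> (h \<otimes>\<^bsub>H\<^esub> evH v), h \<otimes>\<^bsub>H\<^esub> evH v)) \<in> near"
    if "v \<in> group_words Y" for v
    using that
  proof (induction v rule: rev_induct)
    case Nil
    then show ?case using h near_refl base_state by (intro bexI[of _ "[]"]) auto
  next
    case (snoc l v)
    obtain y b where l: "l = (y, b)" by fastforce
    have y: "y \<in> Y" "v \<in> group_words Y" using snoc by (auto simp: l)
    define k where "k = h \<otimes>\<^bsub>H\<^esub> evH v"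
    have k: "k \<in> carrier H" using h y by (simp add: k_def)
    have kl: "h \<otimes>\<^bsub>H\<^esub> evH (v @ [l]) = k \<otimes>\<^bsub>H\<^esub> evH [l]" and l': "evH [l] \<in> carrier H"
      using y h by (simp_all add: l k_def H.ev_append H.m_assoc)
    obtain u where u: "u \<in> group_words X" "(foldl move (\<phi> h, h) u, (\<phi> k, k)) \<in> near"
      using snoc y unfolding k_def by blast
    obtain w where w: "w \<in> group_words X" "m * length w + 1 \<le> N"
      "\<phi> (k \<otimes>\<^bsub>H\<^esub> evH [l]) = \<phi> k \<otimes>\<^bsub>G\<^esub> ev w"
      using short_steps[OF k y(1), of b] unfolding l by blast
    \<comment> \<open>The lift of \<open>w\<close> ends within \<open>m * length w\<close> of
      \<open>k\<close>, and the target is one letter away from \<open>k\<close>. This explains the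
      \<open>+ 1\<close> in \<open>short_steps\<close>.\<close>
    note mv = moves[OF base_state[OF k] w(1)]
    have "inv\<^bsub>H\<^esub> k \<otimes>\<^bsub>H\<^esub> (k \<otimes>\<^bsub>H\<^esub> evH [l]) \<in> H.wball 1"
      using k l' H.letter_in_wball[OF y(1), of b] by (simp add: H.m_assoc[symmetric] l)
    then have "inv\<^bsub>H\<^esub> (snd (foldl move (\<phi> k, k) w)) \<otimes>\<^bsub>H\<^esub> (k \<otimes>\<^bsub>H\<^esub> evH [l]) \<in> H.wball (m * length w + 1)"
      using mv k l' states_closed by (intro H.wball_dist_trans[of _ k] H.wball_dist_sym[of k]) auto
    then have "(foldl move (\<phi> k, k) w, (\<phi> (k \<otimes>\<^bsub>H\<^esub> evH [l]), k \<otimes>\<^bsub>H\<^esub> evH [l])) \<in> near"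
      using mv w k l' H.wball_mono base_state[of "k \<otimes>\<^bsub>H\<^esub> evH [l]"] by (intro nearI) auto
    then have "(foldl move (\<phi> h, h) (u @ w), (\<phi> (k \<otimes>\<^bsub>H\<^esub> evH [l]), k \<otimes>\<^bsub>H\<^esub> evH [l])) \<in> near"
      using near_trans moves_near[OF w(1) u(2)] by simp
    then show ?case using u w unfolding kl by (intro bexI[of _ "u @ w"]) auto
  qed
  moreover obtain v where "v \<in> group_words Y" "evH v = inv\<^bsub>H\<^esub> h \<otimes>\<^bsub>H\<^esub> h'"
    using H.ev_surj[of "inv\<^bsub>H\<^esub> h \<otimes>\<^bsub>H\<^esub> h'"] assms by auto
  ultimately show ?thesis using assms by (metis H.inv_closed H.inv_solve_left H.m_closed)
qed

text \<open>A connected covering without monodromy has a single sheet: both states over the common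
  point are reached from \<open>(\<phi> h, h)\<close> by words with the same value in
  \<open>G\<close>, so \<open>moves_eq\<close> identifies them.\<close>

lemma globally_injective:
  assumes h: "h \<in> carrier H" "h' \<in> carrier H" and a: "a \<in> F" "a' \<in> F"
    and eq: "\<phi> h \<otimes>\<^bsub>G\<^esub> a = \<phi> h' \<otimes>\<^bsub>G\<^esub> a'"
  shows "inv\<^bsub>H\<^esub> h \<otimes>\<^bsub>H\<^esub> h' \<in> H.wball m"
proof -
  \<comment> \<open>A state with error \<open>a\<close> is reached from the base state with the same
    \<open>h\<close> by a word for \<open>a\<close>, short enough for \<open>nearI\<close>.\<close>
  have fibre: "\<exists>w\<in>group_words X. ev w = a \<and> (foldl move (\<phi> h, h) w, (\<phi> h \<otimes>\<^bsub>G\<^esub> a, h)) \<in> near"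
    if h: "h \<in> carrier H" and a: "a \<in> F" for h a
  proof -
    obtain w where w: "w \<in> group_words X" "m * length w + 1 \<le> N" "ev w = a"
      using short_F[OF a] by blast
    note mv = moves[OF base_state[OF h] w(1)]
    have "inv\<^bsub>H\<^esub> (snd (foldl move (\<phi> h, h) w)) \<otimes>\<^bsub>H\<^esub> h \<in> H.wball (m * length w)"
      using mv h states_closed by (intro H.wball_dist_sym[of h]) auto
    moreover have "(\<phi> h \<otimes>\<^bsub>G\<^esub> a, h) \<in> states" using h a by (auto simp: states_def)
    ultimately have "(foldl move (\<phi> h, h) w, (\<phi> h \<otimes>\<^bsub>G\<^esub> a, h)) \<in> near"
      using mv w H.wball_mono[of _ "m * length w" N] by (intro nearI) auto
    then show ?thesis using w by blast
  qed
  obtain v where v: "v \<in> group_words X" "ev v = a" "(foldl move (\<phi> h, h) v, (\<phi> h \<otimes>\<^bsub>G\<^esub> a, h)) \<in> near"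
    using fibre[OF h(1) a(1)] by blast
  obtain v' where v': "v' \<in> group_words X" "ev v' = a'"
    "(foldl move (\<phi> h', h') v', (\<phi> h' \<otimes>\<^bsub>G\<^esub> a', h')) \<in> near"
    using fibre[OF h(2) a(2)] by blast
  obtain w where w: "w \<in> group_words X" "(foldl move (\<phi> h, h) w, (\<phi> h', h')) \<in> near"
    using base_states_connected[OF h] by blast
  have b: "(\<phi> h, h) \<in> states" using base_state h by blast
  have w': "(foldl move (\<phi> h, h) (w @ v'), (\<phi> h' \<otimes>\<^bsub>G\<^esub> a', h')) \<in> near"
    using near_trans[OF moves_near[OF v'(1) w(2)] v'(3)] by simp
  have "\<phi> h \<otimes>\<^bsub>G\<^esub> ev (w @ v') = \<phi> h' \<otimes>\<^bsub>G\<^esub> a'"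
    using moves[OF b, of "w @ v'"] nearD(3)[OF w'] w(1) v'(1) by simp
  then have "ev (w @ v') = ev v"
    using eq v(2) w(1) v'(1) v(1) h G.ev_closed[of v]
      G.Units_l_cancel[of "\<phi> h" "ev (w @ v')" "ev v"] by simp
  then have "(foldl move (\<phi> h, h) v, foldl move (\<phi> h, h) (w @ v')) \<in> near"
    using b w v' v by (intro moves_eq) auto
  then have "((\<phi> h \<otimes>\<^bsub>G\<^esub> a, h), (\<phi> h' \<otimes>\<^bsub>G\<^esub> a', h')) \<in> near"
    using v(3) w' near_sym near_trans by blast
  then show ?thesis by (simp add: near_def)
qed

text \<open>A path in \<open>G\<close> from \<open>\<phi> \<one>\<close> to \<open>g\<close> is
  lifted, and its end is a state over \<open>g\<close>.\<close>

lemma globally_surjective: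
  assumes "g \<in> carrier G"
  shows "\<exists>h\<in>carrier H. \<exists>a\<in>F. g = \<phi> h \<otimes>\<^bsub>G\<^esub> a"
proof -
  let ?e = "(\<phi> \<one>\<^bsub>H\<^esub>, \<one>\<^bsub>H\<^esub>)"
  obtain w where w: "w \<in> group_words X" "ev w = inv\<^bsub>G\<^esub> (\<phi> \<one>\<^bsub>H\<^esub>) \<otimes>\<^bsub>G\<^esub> g"
    using G.ev_surj[of "inv\<^bsub>G\<^esub> (\<phi> \<one>\<^bsub>H\<^esub>) \<otimes>\<^bsub>G\<^esub> g"] assms by auto
  have "foldl move ?e w \<in> states" "fst (foldl move ?e w) = g"
    using moves[OF base_state w(1), of "\<one>\<^bsub>H\<^esub>"] w assms by (auto simp: G.m_assoc[symmetric])
  then obtain h where "(g, h) \<in> states" by (metis prod.collapse)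
  then show ?thesis by (auto simp: states_def)
qed

end

section \<open>Subshifts of finite type\<close>

context group
begin

lemma shift_apply: "g \<in> carrier G \<Longrightarrow> shift G \<sigma> h g = \<sigma> (h \<otimes> g)"
  by (simp add: shift_def)

lemma shift_shift:
  "g \<in> carrier G \<Longrightarrow> h \<in> carrier G \<Longrightarrow> shift G (shift G \<sigma> g) h = shift G \<sigma> (g \<otimes> h)"
  by (auto simp: shift_def m_assoc)

lemma shift_one: "\<sigma> \<in> carrier G \<rightarrow>\<^sub>E A \<Longrightarrow> shift G \<sigma> \<one> = \<sigma>"
  by (auto simp: shift_def PiE_def extensional_def)

lemma shift_in_PiE: "\<sigma> \<in> carrier G \<rightarrow>\<^sub>E A \<Longrightarrow> h \<in> carrier G \<Longrightarrow> shift G \<sigma> h \<in> carrier G \<rightarrow>\<^sub>E A"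
  by (auto simp: shift_def)

text \<open>Shifting by \<open>g\<close> is undone by shifting by \<open>inv g\<close>, so the
  intersection of translated cylinder sets becomes the usual condition on the patterns that occur in
  \<open>\<sigma>\<close>.\<close>

lemma SFT_eq:
  "(\<Inter>g\<in>carrier G. (\<lambda>\<sigma>. shift G \<sigma> g) ` {\<sigma> \<in> carrier G \<rightarrow>\<^sub>E A. restrict \<sigma> S \<in> L})
    = {\<sigma> \<in> carrier G \<rightarrow>\<^sub>E A. \<forall>g\<in>carrier G. restrict (shift G \<sigma> g) S \<in> L}" (is "?I = ?J")
proof (intro subset_antisym subsetI)
  fix \<sigma> assume \<sigma>: "\<sigma> \<in> ?I"
  have "\<sigma> \<in> (\<lambda>\<sigma>. shift G \<sigma> \<one>) ` {\<sigma> \<in> carrier G \<rightarrow>\<^sub>E A. restrict \<sigma> S \<in> L}"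
    using INT_D[OF \<sigma> one_closed] .
  then have "\<sigma> \<in> carrier G \<rightarrow>\<^sub>E A" by (auto simp: shift_one)
  moreover have "restrict (shift G \<sigma> g) S \<in> L" if g: "g \<in> carrier G" for g
  proof -
    have "\<sigma> \<in> (\<lambda>\<sigma>. shift G \<sigma> (inv g)) ` {\<sigma> \<in> carrier G \<rightarrow>\<^sub>E A. restrict \<sigma> S \<in> L}"
      using INT_D[OF \<sigma> inv_closed[OF g]] .
    then obtain \<tau> where \<tau>: "\<sigma> = shift G \<tau> (inv g)" "\<tau> \<in> carrier G \<rightarrow>\<^sub>E A" "restrict \<tau> S \<in> L" by blast
    then have "shift G \<sigma> g = \<tau>" using g by (simp add: shift_shift shift_one)
    then show ?thesis using \<tau> by simp
  qed
  ultimately show "\<sigma> \<in> ?J" by blast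
next
  fix \<sigma> assume \<sigma>: "\<sigma> \<in> ?J"
  then have \<sigma>A: "\<sigma> \<in> carrier G \<rightarrow>\<^sub>E A" by blast
  show "\<sigma> \<in> ?I"
  proof
    fix g assume g: "g \<in> carrier G"
    have "\<sigma> = shift G (shift G \<sigma> (inv g)) g"
      using g by (simp add: shift_shift shift_one[OF \<sigma>A])
    moreover have "shift G \<sigma> (inv g) \<in> {\<sigma> \<in> carrier G \<rightarrow>\<^sub>E A. restrict \<sigma> S \<in> L}"
      using \<sigma> g shift_in_PiE[OF \<sigma>A] by auto
    ultimately show "\<sigma> \<in> (\<lambda>\<sigma>. shift G \<sigma> g) ` {\<sigma> \<in> carrier G \<rightarrow>\<^sub>E A. restrict \<sigma> S \<in> L}" by blast
  qed
qed

text \<open>For fixed \<open>g\<close> the condition is a union of cylinders over the patterns in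
  \<open>L\<close>. The union is finite because \<open>A\<close> and \<open>S\<close> are finite, so
  it is closed, and closed sets may be intersected over all \<open>g\<close>.\<close>

lemma subshift_SFT:
  assumes "finite A" "finite S" "S \<subseteq> carrier G" "L \<subseteq> S \<rightarrow>\<^sub>E A"
  shows "subshift G A {\<sigma> \<in> carrier G \<rightarrow>\<^sub>E A. \<forall>g\<in>carrier G. restrict (shift G \<sigma> g) S \<in> L}"
  unfolding subshift_def
proof (intro conjI ballI)
  let ?T = "product_topology (\<lambda>_. discrete_topology A) (carrier G)"
  have top: "topspace ?T = carrier G \<rightarrow>\<^sub>E A" by simp
  have pattern: "closedin ?T {\<sigma> \<in> carrier G \<rightarrow>\<^sub>E A. restrict (shift G \<sigma> g) S = p}"
    if g: "g \<in> carrier G" and p: "p \<in> L" for g p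
  proof -
    \<comment> \<open>Inserting the whole space keeps the family nonempty when \<open>S\<close> is
      empty and its intersection inside the space.\<close>
    let ?C = "insert (topspace ?T) ((\<lambda>s. {\<sigma> \<in> topspace ?T. \<sigma> (g \<otimes> s) \<in> {p s}}) ` S)"
    have "closedin ?T {\<sigma> \<in> topspace ?T. \<sigma> (g \<otimes> s) \<in> {p s}}" if s: "s \<in> S" for s
    proof (rule closedin_continuous_map_preimage)
      show "continuous_map ?T (discrete_topology A) (\<lambda>\<sigma>. \<sigma> (g \<otimes> s))"
        using g s assms(3) by (intro continuous_map_product_projection) auto
      show "closedin (discrete_topology A) {p s}" using p s assms(4) by auto
    qed
    then have "closedin ?T (\<Inter>?C)"
      using closedin_topspace[of ?T] by (intro closedin_Inter) auto
    moreover have "\<Inter>?C = {\<sigma> \<in> carrier G \<rightarrow>\<^sub>E A. restrict (shift G \<sigma> g) S = p}"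
    proof -
      have "restrict (shift G \<sigma> g) S = p \<longleftrightarrow> (\<forall>s\<in>S. \<sigma> (g \<otimes> s) = p s)" for \<sigma>
      proof -
        have "p \<in> extensional S" using p assms(4) by (auto simp: PiE_def)
        then have "restrict (shift G \<sigma> g) S = p \<longleftrightarrow> (\<forall>s\<in>S. shift G \<sigma> g s = p s)"
          by (auto simp: fun_eq_iff extensional_def)
        then show ?thesis using assms(3) shift_apply by (metis subsetD)
      qed
      then show ?thesis by (auto simp: top simp del: topspace_product_topology)
    qed
    ultimately show ?thesis by simp
  qed
  have "finite L" using assms by (meson finite_PiE finite_subset)
  then have "closedin ?T (\<Union>p\<in>L. {\<sigma> \<in> carrier G \<rightarrow>\<^sub>E A. restrict (shift G \<sigma> g) S = p})"
    if "g \<in> carrier G" for g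
    using pattern that by (intro closedin_Union) auto
  then have "closedin ?T (\<Inter>g\<in>carrier G. \<Union>p\<in>L. {\<sigma> \<in> carrier G \<rightarrow>\<^sub>E A. restrict (shift G \<sigma> g) S = p})"
    by (intro closedin_Inter) auto
  also have "(\<Inter>g\<in>carrier G. \<Union>p\<in>L. {\<sigma> \<in> carrier G \<rightarrow>\<^sub>E A. restrict (shift G \<sigma> g) S = p})
    = {\<sigma> \<in> carrier G \<rightarrow>\<^sub>E A. \<forall>g\<in>carrier G. restrict (shift G \<sigma> g) S \<in> L}"
    using one_closed by blast
  finally show "closedin ?T {\<sigma> \<in> carrier G \<rightarrow>\<^sub>E A. \<forall>g\<in>carrier G. restrict (shift G \<sigma> g) S \<in> L}" .
next
  fix \<sigma> h
  assume "\<sigma> \<in> {\<sigma> \<in> carrier G \<rightarrow>\<^sub>E A. \<forall>g\<in>carrier G. restrict (shift G \<sigma> g) S \<in> L}" "h \<in> carrier G"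
  then show "shift G \<sigma> h \<in> {\<sigma> \<in> carrier G \<rightarrow>\<^sub>E A. \<forall>g\<in>carrier G. restrict (shift G \<sigma> g) S \<in> L}"
    by (simp add: shift_shift shift_in_PiE)
qed

text \<open>Frees the main construction from encodings: the finite alphabet may have any type,
  configurations need not be extensional, and the allowed patterns are given by a predicate that
  looks only at \<open>D\<close>. An enumeration of \<open>A\<close> transports everything to
  natural numbers.\<close>

lemma admits_strongly_aperiodic_SFT_local_rule:
  fixes A :: "'s set" and P :: "('a \<Rightarrow> 's) \<Rightarrow> bool"
  assumes A: "finite A" and D: "finite D" "D \<subseteq> carrier G"
    and local_rule: "\<And>y y'. \<lbrakk>\<And>d. d \<in> D \<Longrightarrow> y d = y' d; P y\<rbrakk> \<Longrightarrow> P y'"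
    and y0: "y0 \<in> carrier G \<rightarrow> A" "\<And>g. g \<in> carrier G \<Longrightarrow> P (\<lambda>k. y0 (g \<otimes> k))"
    and aperiodic: "\<And>y h. \<lbrakk>y \<in> carrier G \<rightarrow> A; \<And>g. g \<in> carrier G \<Longrightarrow> P (\<lambda>k. y (g \<otimes> k));
      h \<in> carrier G; \<And>k. k \<in> carrier G \<Longrightarrow> y (h \<otimes> k) = y k\<rbrakk> \<Longrightarrow> h = \<one>"
  shows "admits_strongly_aperiodic_SFT G"
proof -
  let ?enc = "to_nat_on A" and ?dec = "from_nat_into A"
  have dec: "?dec (?enc a) = a" if "a \<in> A" for a
    using that A by (simp add: countable_finite)
  let ?B = "?enc ` A"
  \<comment> \<open>Off \<open>D\<close> the decoded pattern has arbitrary values; by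
    \<open>local_rule\<close> they do not affect \<open>P\<close>.\<close>
  define L where "L = {p \<in> D \<rightarrow>\<^sub>E ?B. P (?dec \<circ> p)}"
  define Y where "Y = {\<sigma> \<in> carrier G \<rightarrow>\<^sub>E ?B. \<forall>g\<in>carrier G. restrict (shift G \<sigma> g) D \<in> L}"
  have rule: "restrict (shift G \<sigma> g) D \<in> L \<longleftrightarrow> P (\<lambda>k. ?dec (\<sigma> (g \<otimes> k)))"
    if \<sigma>: "\<sigma> \<in> carrier G \<rightarrow>\<^sub>E ?B" and g: "g \<in> carrier G" for \<sigma> g
  proof -
    have eq: "(?dec \<circ> restrict (shift G \<sigma> g) D) d = ?dec (\<sigma> (g \<otimes> d))" if "d \<in> D" for d
      using that D(2) by (auto simp: shift_apply)
    have "restrict (shift G \<sigma> g) D \<in> D \<rightarrow>\<^sub>E ?B"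
      using shift_in_PiE[OF \<sigma> g] D(2) by auto
    moreover have "P (?dec \<circ> restrict (shift G \<sigma> g) D) \<longleftrightarrow> P (\<lambda>k. ?dec (\<sigma> (g \<otimes> k)))"
      using local_rule eq by metis
    ultimately show ?thesis by (simp add: L_def)
  qed
  have L: "L \<subseteq> D \<rightarrow>\<^sub>E ?B" by (auto simp: L_def)
  have sft: "subshift_of_finite_type G ?B Y"
    unfolding subshift_of_finite_type_def SFT_eq Y_def using D L by blast
  have sub: "subshift G ?B Y"
    unfolding Y_def using A D L by (intro subshift_SFT) auto
  let ?\<sigma>0 = "\<lambda>g\<in>carrier G. ?enc (y0 g)"
  have \<sigma>0: "?\<sigma>0 \<in> carrier G \<rightarrow>\<^sub>E ?B" using y0(1) by auto
  have "P (\<lambda>k. ?dec (?\<sigma>0 (g \<otimes> k)))" if "g \<in> carrier G" for g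
    using y0(1) that D(2) by (intro local_rule[OF _ y0(2)[OF that]]) (auto simp: dec Pi_iff subset_iff)
  then have ne: "?\<sigma>0 \<in> Y" using \<sigma>0 by (simp add: Y_def rule)
  have "{h \<in> carrier G. shift G \<sigma> h = \<sigma>} = {\<one>}" if \<sigma>: "\<sigma> \<in> Y" for \<sigma>
  proof -
    have \<sigma>B: "\<sigma> \<in> carrier G \<rightarrow>\<^sub>E ?B" using \<sigma> by (simp add: Y_def)
    have "h = \<one>" if h: "h \<in> carrier G" "shift G \<sigma> h = \<sigma>" for h
    proof (rule aperiodic[of "\<lambda>g. ?dec (\<sigma> g)"])
      show "(\<lambda>g. ?dec (\<sigma> g)) \<in> carrier G \<rightarrow> A" 
      proof
        fix g assume "g \<in> carrier G"
        then obtain a where "a \<in> A" "\<sigma> g = ?enc a" using \<sigma>B by blast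
        then show "?dec (\<sigma> g) \<in> A" by (simp add: dec)
      qed
      show "P (\<lambda>k. ?dec (\<sigma> (g \<otimes> k)))" if "g \<in> carrier G" for g
        using \<sigma> that rule[OF \<sigma>B that] by (simp add: Y_def)
      show "?dec (\<sigma> (h \<otimes> k)) = ?dec (\<sigma> k)" if "k \<in> carrier G" for k
        using shift_apply[OF that, of \<sigma> h] h by simp
    qed (fact h(1))
    then show ?thesis using shift_one[OF \<sigma>B] by auto
  qed
  then have "strongly_aperiodic G ?B Y" using sub ne by (auto simp: strongly_aperiodic_def)
  then show ?thesis unfolding admits_strongly_aperiodic_SFT_def using sft A by blast
qed

end

section \<open>Quasi-isometries as coarse equivalences\<close>

text \<open>Finite sets of differences \<open>inv g \<otimes> g'\<close> replace the constants of a
  quasi-isometry, which removes all reference to generating sets. After the typing condition the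
  clauses are control, properness and coarse surjectivity.\<close>

definition coarse_equivalence ::
    "('a, 'c) monoid_scheme \<Rightarrow> ('b, 'd) monoid_scheme \<Rightarrow> ('a \<Rightarrow> 'b) \<Rightarrow> bool" where
  "coarse_equivalence G H \<phi> \<longleftrightarrow>
     \<phi> \<in> carrier G \<rightarrow> carrier H \<and>
     (\<forall>F. finite F \<and> F \<subseteq> carrier G \<longrightarrow> (\<exists>F'. finite F' \<and> F' \<subseteq> carrier H \<and>
        (\<forall>g\<in>carrier G. \<forall>g'\<in>carrier G. inv\<^bsub>G\<^esub> g \<otimes>\<^bsub>G\<^esub> g' \<in> F \<longrightarrow> inv\<^bsub>H\<^esub> (\<phi> g) \<otimes>\<^bsub>H\<^esub> \<phi> g' \<in> F'))) \<and>
     (\<forall>F. finite F \<and> F \<subseteq> carrier H \<longrightarrow> (\<exists>F'. finite F' \<and> F' \<subseteq> carrier G \<and>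
        (\<forall>g\<in>carrier G. \<forall>g'\<in>carrier G. inv\<^bsub>H\<^esub> (\<phi> g) \<otimes>\<^bsub>H\<^esub> \<phi> g' \<in> F \<longrightarrow> inv\<^bsub>G\<^esub> g \<otimes>\<^bsub>G\<^esub> g' \<in> F'))) \<and>
     (\<exists>F. finite F \<and> F \<subseteq> carrier H \<and> (\<forall>h\<in>carrier H. \<exists>g\<in>carrier G. inv\<^bsub>H\<^esub> (\<phi> g) \<otimes>\<^bsub>H\<^esub> h \<in> F))"

section \<open>Distances in geometric realizations\<close>

lemma graph_dist_le_chain_length:
  assumes "graph_chain V E p q ps"
  shows "graph_dist V E p q \<le> chain_length ps"
proof -
  have "p \<in> graph_realization V E" "q \<in> graph_realization V E"
    using assms hd_in_set last_in_set unfolding graph_chain_def by blast+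
  moreover have "bdd_below (chain_length ` {ps. graph_chain V E p q ps})"
    by (rule bdd_belowI[of _ 0]) (auto simp: chain_length_nonneg)
  ultimately show ?thesis using assms by (auto simp: graph_dist_def intro: cInf_lower)
qed

text \<open>Both points have total mass 1, so their l1 distance is at most 2, and
  \<open>segment_length\<close> is half of it.\<close>

lemma segment_length_le_1:
  assumes "p \<in> graph_realization V E" "q \<in> graph_realization V E"
  shows "segment_length p q \<le> 1"
proof -
  let ?P = "{v. p v \<noteq> 0}" and ?Q = "{v. q v \<noteq> 0}"
  have fin: "finite ?P" "finite ?Q" using assms by (auto simp: finite_support_graph_realization)
  have pos: "0 \<le> p v" "0 \<le> q v" and one: "sum p ?P = 1" "sum q ?Q = 1" for v
    using assms by (auto simp: graph_realization_def)
  have "(\<Sum>v\<in>?P \<union> ?Q. \<bar>p v - q v\<bar>) \<le> (\<Sum>v\<in>?P \<union> ?Q. p v + q v)"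
    using pos by (intro sum_mono) (simp add: abs_le_iff add_increasing add_increasing2)
  also have "\<dots> = sum p ?P + sum q ?Q"
    unfolding sum.distrib using fin
    by (intro arg_cong2[of _ _ _ _ "(+)"] sum.mono_neutral_right) auto
  finally show ?thesis using one segment_length_superset[of "?P \<union> ?Q" p q] fin by simp
qed

lemma graph_dist_common_cell:
  assumes "p \<in> graph_realization V E" "q \<in> graph_realization V E" "in_common_cell V E p q"
  shows "graph_dist V E p q \<le> 1"
  using graph_dist_le_chain_length[of V E p q "[p, q]"] segment_length_le_1[OF assms(1,2)] assms
  by (simp add: graph_chain_def)

text \<open>The linear extension of a function on the vertices. For the word length it is 1-Lipschitz, so
  graph distances bound word lengths from above.\<close>

definition potential :: "('v \<Rightarrow> real) \<Rightarrow> ('v \<Rightarrow> real) \<Rightarrow> real" where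
  "potential d p = (\<Sum>v | p v \<noteq> 0. p v * d v)"

text \<open>On an edge a point is determined by one barycentric coordinate, and the potential
  changes by the change of that coordinate times \<open>d u - d v\<close>.\<close>

lemma potential_common_cell:
  assumes E: "\<And>c. c \<in> E \<Longrightarrow> \<exists>u v. u \<noteq> v \<and> c = {u, v}"
    and d: "\<And>u v. {u, v} \<in> E \<Longrightarrow> d u - d v \<le> 1"
    and pq: "p \<in> graph_realization V E" "q \<in> graph_realization V E" and cell: "in_common_cell V E p q"
  shows "potential d p - potential d q \<le> segment_length p q"
proof -
  obtain c where c: "c \<in> graph_cells V E" "{v. p v \<noteq> 0} \<subseteq> c" "{v. q v \<noteq> 0} \<subseteq> c"
    using cell by (auto simp: in_common_cell_def)
  have fin: "finite c"
  proof (cases "c \<in> E")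
    case True
    with E show ?thesis by fastforce
  qed (use c in \<open>auto simp: graph_cells_def\<close>)
  have pot: "potential d r = (\<Sum>v\<in>c. r v * d v)" "sum r c = 1"
    if "r \<in> graph_realization V E" "{v. r v \<noteq> 0} \<subseteq> c" for r
  proof -
    show "potential d r = (\<Sum>v\<in>c. r v * d v)"
      unfolding potential_def using fin that by (intro sum.mono_neutral_left) auto
    have "sum r c = sum r {v. r v \<noteq> 0}"
      using fin that by (intro sum.mono_neutral_right) auto
    then show "sum r c = 1" using that by (simp add: graph_realization_def)
  qed
  note p = pot[OF pq(1) c(2)] and q = pot[OF pq(2) c(3)]
  note seg = segment_length_superset[OF fin c(2,3)]
  show ?thesis
  proof (cases "c \<in> E")
    case True
    then obtain u v where uv: "u \<noteq> v" "c = {u, v}" using E by blast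
    have pu: "p v = 1 - p u" and qu: "q v = 1 - q u" using p q uv by auto
    have "potential d p - potential d q = (p u - q u) * (d u - d v)"
      using uv by (simp add: p q pu qu algebra_simps)
    also have "\<dots> \<le> \<bar>p u - q u\<bar> * 1"
    proof -
      have "\<bar>d u - d v\<bar> \<le> 1" using d[of u v] d[of v u] True uv by (auto simp: insert_commute)
      then have "\<bar>p u - q u\<bar> * \<bar>d u - d v\<bar> \<le> \<bar>p u - q u\<bar> * 1" by (intro mult_left_mono) auto
      then show ?thesis by (simp add: abs_mult[symmetric])
    qed
    also have "\<dots> = segment_length p q"
      using uv by (simp add: seg pu qu abs_minus_commute[of "p u"])
    finally show ?thesis .
  next
    case False
    then obtain v where "c = {v}" using c by (auto simp: graph_cells_def)
    then show ?thesis using p q segment_length_nonneg[of p q] by simp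
  qed
qed

text \<open>Summation along a chain telescopes, and the bound passes to the infimum;
  \<open>conn\<close> ensures that the infimum is over a nonempty set.\<close>

lemma potential_le_graph_dist:
  assumes E: "\<And>c. c \<in> E \<Longrightarrow> \<exists>u v. u \<noteq> v \<and> c = {u, v}"
    and d: "\<And>u v. {u, v} \<in> E \<Longrightarrow> d u - d v \<le> 1"
    and conn: "\<exists>ps. graph_chain V E p q ps"
  shows "potential d p - potential d q \<le> graph_dist V E p q"
proof -
  have chain: "potential d (hd ps) - potential d (last ps) \<le> chain_length ps"
    if "ps \<noteq> []" "set ps \<subseteq> graph_realization V E" "successively (in_common_cell V E) ps" for ps
    using that
  proof (induction ps rule: chain_length.induct)
    case (1 p q ps)
    then show ?case using potential_common_cell[OF E d, where p = p and q = q and V = V]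
      by force
  qed auto
  have le: "potential d p - potential d q \<le> x" if "x \<in> chain_length ` {ps. graph_chain V E p q ps}" for x
    using that chain by (auto simp: graph_chain_def)
  have "p \<in> graph_realization V E" "q \<in> graph_realization V E"
    using conn hd_in_set last_in_set unfolding graph_chain_def by blast+
  then show ?thesis using conn le by (auto simp: graph_dist_def intro!: cInf_greatest)
qed

definition vertex :: "'v \<Rightarrow> 'v \<Rightarrow> real" where
  "vertex g = (\<lambda>v. of_bool (v = g))"

lemma support_vertex [simp]: "{v. vertex g v \<noteq> 0} = {g}"
  by (auto simp: vertex_def)

lemma vertex_in_realization: "g \<in> V \<Longrightarrow> vertex g \<in> graph_realization V E"
  unfolding graph_realization_def mem_Collect_eq support_vertex
  by (auto simp: vertex_def graph_cells_def)

lemma potential_vertex [simp]: "potential d (vertex g) = d g"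
  unfolding potential_def support_vertex by (simp add: vertex_def)

lemma support_nonempty:
  assumes "p \<in> graph_realization V E"
  shows "\<exists>v. p v \<noteq> 0"
proof (rule ccontr)
  assume "\<not> (\<exists>v. p v \<noteq> 0)"
  then show False using assms by (simp add: graph_realization_def)
qed

text \<open>Rounds points of the realization to vertices, so that a map between Cayley graphs yields
  a map between the groups.\<close>

lemma near_support_vertex:
  assumes E: "\<And>c. c \<in> E \<Longrightarrow> c \<subseteq> V" and p: "p \<in> graph_realization V E" and v: "p v \<noteq> 0"
  shows "v \<in> V" "graph_dist V E p (vertex v) \<le> 1"
proof -
  have cell: "{v. p v \<noteq> 0} \<in> graph_cells V E" using p by (simp add: graph_realization_def)
  then consider w where "{v. p v \<noteq> 0} = {w}" "w \<in> V" | "{v. p v \<noteq> 0} \<in> E"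
    by (auto simp: graph_cells_def)
  then show vV: "v \<in> V"
  proof cases
    case 1
    have "v \<in> {w}" using v unfolding 1(1)[symmetric] by simp
    then show ?thesis using 1 by simp
  next
    case 2
    then show ?thesis using E[OF 2] v by auto
  qed
  have "in_common_cell V E p (vertex v)"
    unfolding in_common_cell_def support_vertex using cell v by (intro bexI[OF _ cell]) auto
  then show "graph_dist V E p (vertex v) \<le> 1"
    using p vV by (intro graph_dist_common_cell vertex_in_realization)
qed

section \<open>Word balls and Cayley distances\<close>

context group
begin

text \<open>Unlike \<open>wball\<close>, this ball belongs to the generating set of a Cayley graph,
  for which no presentation is given.\<close>

primrec gball :: "'a set \<Rightarrow> nat \<Rightarrow> 'a set" where
  "gball S 0 = {\<one>}"
| "gball S (Suc n) = gball S n \<union> {g \<otimes> s | g s. g \<in> gball S n \<and> (s \<in> S \<or> s \<in> m_inv G ` S)}"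

lemma gball_closed: "S \<subseteq> carrier G \<Longrightarrow> gball S n \<subseteq> carrier G"
  by (induction n) auto

lemma finite_gball:
  assumes "finite S"
  shows "finite (gball S n)"
proof (induction n)
  case 0
  show ?case by simp
next
  case (Suc n)
  have "{g \<otimes> s | g s. g \<in> gball S n \<and> (s \<in> S \<or> s \<in> m_inv G ` S)}
    \<subseteq> (\<lambda>(g, s). g \<otimes> s) ` (gball S n \<times> (S \<union> m_inv G ` S))" by auto
  moreover have "finite ((\<lambda>(g, s). g \<otimes> s) ` (gball S n \<times> (S \<union> m_inv G ` S)))"
    using Suc assms by simp
  ultimately show ?case using Suc finite_subset by simp
qed

lemma gball_mono:
  assumes "m \<le> n"
  shows "gball S m \<subseteq> gball S n"
proof -
  have "gball S n \<subseteq> gball S (Suc n)" for n by simp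
  from lift_Suc_mono_le[of "gball S", OF this assms] show ?thesis .
qed

lemma gball_mult:
  assumes S: "S \<subseteq> carrier G" and "g \<in> gball S m" "h \<in> gball S n"
  shows "g \<otimes> h \<in> gball S (m + n)"
  using assms(3)
proof (induction n arbitrary: h)
  case 0
  then show ?case using assms(2) gball_closed[OF S, of m] by auto
next
  case (Suc n)
  show ?case
  proof (cases "h \<in> gball S n")
    case False
    then obtain h' s where hs: "h = h' \<otimes> s" "h' \<in> gball S n" "s \<in> S \<or> s \<in> m_inv G ` S"
      using Suc by auto
    moreover have "g \<in> carrier G" "h' \<in> carrier G" "s \<in> carrier G"
      using hs S assms(2) gball_closed[OF S] by auto
    ultimately have "g \<otimes> h = (g \<otimes> h') \<otimes> s" by (simp add: m_assoc)
    then show ?thesis using Suc.IH[OF hs(2)] hs(3) by auto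
  qed (simp add: Suc.IH)
qed

lemma generate_gball:
  assumes S: "S \<subseteq> carrier G" and "h \<in> generate G S"
  shows "\<exists>n. h \<in> gball S n"
  using assms(2)
proof induction
  case one
  then show ?case by (intro exI[of _ 0]) simp
next
  case (incl h)
  then have "h = \<one> \<otimes> h" using S by auto
  then show ?case using incl by (intro exI[of _ 1]) auto
next
  case (inv h)
  then have "inv h = \<one> \<otimes> inv h" using S by auto
  then show ?case using inv by (intro exI[of _ 1]) auto
next
  case (eng h1 h2)
  then show ?case using gball_mult[OF S] by blast
qed

lemma finite_subset_gball:
  assumes S: "generates G S" and "finite F" "F \<subseteq> carrier G"
  shows "\<exists>n. F \<subseteq> gball S n"
  using assms(2,3)
proof induction
  case (insert g F)
  obtain m n where "g \<in> gball S m" "F \<subseteq> gball S n"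
    using insert generate_gball[of S g] S by (auto simp: generates_def)
  then have "insert g F \<subseteq> gball S (max m n)"
    using gball_mono[of m "max m n" S] gball_mono[of n "max m n" S] by auto
  then show ?case by blast
qed auto

lemma cayley_edge_subset: "S \<subseteq> carrier G \<Longrightarrow> c \<in> cayley_edges G S \<Longrightarrow> c \<subseteq> carrier G"
  by (auto simp: cayley_edges_def)

lemma cayley_dist_vertex_le:
  assumes S: "generates G S" and "g \<in> carrier G" "k \<in> gball S n"
  shows "cayley_dist G S (vertex g) (vertex (g \<otimes> k)) \<le> n"
  using assms(3)
proof (induction n arbitrary: k)
  interpret M: Metric_space "cayley_space G S" "cayley_dist G S"
    using Metric_space_cayley[OF is_group S] .
  have SG: "S \<subseteq> carrier G" using S by (simp add: generates_def)
  have vert: "vertex k \<in> cayley_space G S" if "k \<in> carrier G" for k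
    using that by (simp add: cayley_space_def vertex_in_realization)
  {
    case 0
    then show ?case using vert assms(2) by simp
  next
    case (Suc n)
    show ?case
    proof (cases "k \<in> gball S n")
      case False
      then obtain k' s where ks: "k = k' \<otimes> s" "k' \<in> gball S n" "s \<in> S \<or> s \<in> m_inv G ` S"
        using Suc by auto
      have carr: "k' \<in> carrier G" "s \<in> carrier G" using ks SG gball_closed[OF SG] by auto
      have k: "g \<otimes> k = (g \<otimes> k') \<otimes> s" using carr assms(2) by (simp add: ks m_assoc)
      have step: "cayley_dist G S (vertex h) (vertex (h \<otimes> s)) \<le> 1" if "h \<in> carrier G" "s \<in> S" for h s
      proof (cases "s = \<one>")
        case True
        then show ?thesis using that vert by simp
      next
        case False
        then have "{h, h \<otimes> s} \<in> graph_cells (carrier G) (cayley_edges G S)"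
          using that by (auto simp: graph_cells_def cayley_edges_def)
        then have "in_common_cell (carrier G) (cayley_edges G S) (vertex h) (vertex (h \<otimes> s))"
          unfolding in_common_cell_def support_vertex by (rule bexI[rotated]) simp
        then show ?thesis
          unfolding cayley_dist_def using that SG
          by (intro graph_dist_common_cell vertex_in_realization) auto
      qed
      have "cayley_dist G S (vertex (g \<otimes> k')) (vertex (g \<otimes> k' \<otimes> s)) \<le> 1"
      proof (cases "s \<in> S")
        \<comment> \<open>An inverse generator traverses an edge backwards, starting from
          \<open>g \<otimes> k' \<otimes> s\<close>.\<close>
        case False
        then obtain t where t: "t \<in> S" "s = inv t" using ks by auto
        then have "g \<otimes> k' \<otimes> s \<otimes> t = g \<otimes> k'" using carr assms(2) SG by (simp add: m_assoc subset_iff)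
        then show ?thesis using step[of "g \<otimes> k' \<otimes> s" t] t carr assms(2) M.commute by auto
      qed (use step carr assms(2) in auto)
      then show ?thesis
        using Suc.IH[OF ks(2)] M.triangle[OF vert vert vert, of g "g \<otimes> k'" "g \<otimes> k"] assms(2) carr
        by (simp add: k)
    qed (use Suc.IH in force)
  }
qed

text \<open>The word length of \<open>inv g \<otimes> v\<close>, as a function of \<open>v\<close>,
  changes by at most 1 along every edge. Its linear extension therefore bounds the Cayley distance
  from below, also for chains through interior points of edges.\<close>

lemma gball_of_cayley_dist:
  assumes S: "generates G S" and gh: "g \<in> carrier G" "h \<in> carrier G"
    and dist: "cayley_dist G S (vertex g) (vertex h) \<le> real n"
  shows "inv g \<otimes> h \<in> gball S n"
proof -
  have SG: "S \<subseteq> carrier G" using S by (simp add: generates_def)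
  define len where "len k = (LEAST n. k \<in> gball S n)" for k
  have len: "k \<in> gball S (len k)" if "k \<in> carrier G" for k
  proof -
    have "\<exists>n. k \<in> gball S n"
      using generate_gball[OF SG, of k] that S by (simp add: generates_def)
    then show ?thesis unfolding len_def by (rule LeastI_ex)
  qed
  have len_le: "len k \<le> n" if "k \<in> gball S n" for k n
    unfolding len_def using that by (rule Least_le)
  have step: "len (k \<otimes> s) \<le> len k + 1" if "k \<in> carrier G" "s \<in> S \<or> s \<in> m_inv G ` S" for k s
    using len[OF that(1)] that by (intro len_le) auto
  define d where "d v = real (len (inv g \<otimes> v))" for v
  have "potential d (vertex h) - potential d (vertex g)
    \<le> graph_dist (carrier G) (cayley_edges G S) (vertex h) (vertex g)"
  proof (rule potential_le_graph_dist)
    show "\<exists>u v. u \<noteq> v \<and> c = {u, v}" if "c \<in> cayley_edges G S" for c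
    proof -
      from that obtain k s where ks: "c = {k, k \<otimes> s}" "k \<in> carrier G" "s \<in> S" "s \<noteq> \<one>"
        by (auto simp: cayley_edges_def)
      then have "k \<noteq> k \<otimes> s" using SG by (metis l_cancel_one' subsetD)
      with ks show ?thesis by blast
    qed
    show "d u - d v \<le> 1" if uv: "{u, v} \<in> cayley_edges G S" for u v
    proof -
      obtain k s where ks: "{u, v} = {k, k \<otimes> s}" "k \<in> carrier G" "s \<in> S"
        using uv unfolding cayley_edges_def by blast
      have s: "s \<in> carrier G" using ks SG by auto
      have "len (inv g \<otimes> k \<otimes> s) \<le> len (inv g \<otimes> k) + 1"
        using ks gh by (intro step) auto
      moreover have "len (inv g \<otimes> k \<otimes> s \<otimes> inv s) \<le> len (inv g \<otimes> k \<otimes> s) + 1"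
        using ks gh s by (intro step) auto
      moreover have "inv g \<otimes> k \<otimes> s \<otimes> inv s = inv g \<otimes> k" "inv g \<otimes> (k \<otimes> s) = inv g \<otimes> k \<otimes> s"
        using ks gh s by (simp_all add: m_assoc)
      ultimately have "d (k \<otimes> s) - d k \<le> 1" "d k - d (k \<otimes> s) \<le> 1" by (simp_all add: d_def)
      moreover have "u = k \<and> v = k \<otimes> s \<or> u = k \<otimes> s \<and> v = k" using ks by (auto simp: doubleton_eq_iff)
      ultimately show ?thesis by auto
    qed
    show "\<exists>ps. graph_chain (carrier G) (cayley_edges G S) (vertex h) (vertex g) ps"
      using gh by (intro cayley_connected[OF is_group S]) (auto simp: cayley_space_def vertex_in_realization)
  qed
  moreover have "len \<one> = 0" using len_le[of "\<one>" 0] by simp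
  moreover have "cayley_dist G S (vertex h) (vertex g) \<le> real n"
    using dist Metric_space.commute[OF Metric_space_cayley[OF is_group S]] by metis
  ultimately have "len (inv g \<otimes> h) \<le> n" using gh by (simp add: d_def cayley_dist_def)
  then show ?thesis using len gh gball_mono by (meson inv_closed m_closed subsetD)
qed

end

text \<open>The quasi-isometry is restricted to vertices and its values are rounded to vertices.
  Balls are then the required finite sets, with radii computed from \<open>n\<close>.\<close>

lemma quasi_isometric_groups_coarse_equivalence:
  assumes "group G" "group H" "quasi_isometric_groups G H"
  shows "\<exists>\<phi>. coarse_equivalence G H \<phi>"
proof -
  interpret G: group G by fact
  interpret H: group H by fact
  obtain S T f n where S: "finite S" "generates G S" and T: "finite T" "generates H T" and n: "n > 0"
    and emb: "quasi_isometric_embedding n (cayley_space G S) (cayley_dist G S)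
                 (cayley_space H T) (cayley_dist H T) f"
    and surj: "quasi_surjective n (cayley_space G S) (cayley_space H T) (cayley_dist H T) f"
    using assms(3) by (auto simp: quasi_isometric_groups_def quasi_isometry_def)
  let ?X = "cayley_space G S" and ?dX = "cayley_dist G S"
  let ?Y = "cayley_space H T" and ?dY = "cayley_dist H T"
  interpret X: Metric_space ?X ?dX using Metric_space_cayley[OF assms(1) S(2)] .
  interpret Y: Metric_space ?Y ?dY using Metric_space_cayley[OF assms(2) T(2)] .
  have SG: "S \<subseteq> carrier G" and TH: "T \<subseteq> carrier H" using S T by (auto simp: generates_def)
  have vX: "vertex g \<in> ?X" if "g \<in> carrier G" for g
    using that by (simp add: cayley_space_def vertex_in_realization)
  have vY: "vertex h \<in> ?Y" if "h \<in> carrier H" for h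
    using that by (simp add: cayley_space_def vertex_in_realization)
  have fY: "f x \<in> ?Y" if "x \<in> ?X" for x
    using emb that by (auto simp: quasi_isometric_embedding_def)
  have upper: "?dY (f x) (f x') \<le> n * ?dX x x' + n" if "x \<in> ?X" "x' \<in> ?X" for x x'
    using emb that by (auto simp: quasi_isometric_embedding_def)
  have lower: "?dX x x' \<le> n * (?dY (f x) (f x') + n)" if "x \<in> ?X" "x' \<in> ?X" for x x'
  proof -
    have "?dX x x' / n \<le> ?dY (f x) (f x') + n"
      using emb that by (force simp: quasi_isometric_embedding_def)
    then show ?thesis using n by (simp add: field_simps)
  qed
  \<comment> \<open>The image of a vertex may lie inside an edge; any vertex of its support is at
    distance at most 1.\<close>
  define \<phi> where "\<phi> g = (SOME v. f (vertex g) v \<noteq> 0)" for g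
  have \<phi>: "\<phi> g \<in> carrier H" "?dY (f (vertex g)) (vertex (\<phi> g)) \<le> 1" if "g \<in> carrier G" for g
  proof -
    have p: "f (vertex g) \<in> graph_realization (carrier H) (cayley_edges H T)"
      using fY[OF vX[OF that]] by (simp add: cayley_space_def)
    have "f (vertex g) (\<phi> g) \<noteq> 0" unfolding \<phi>_def by (rule someI_ex) (rule support_nonempty[OF p])
    from near_support_vertex[OF H.cayley_edge_subset[OF TH] p this]
    show "\<phi> g \<in> carrier H" "?dY (f (vertex g)) (vertex (\<phi> g)) \<le> 1"
      by (auto simp: cayley_dist_def)
  qed
  have close: "\<bar>?dY (f (vertex g)) (f (vertex g')) - ?dY (vertex (\<phi> g)) (vertex (\<phi> g'))\<bar> \<le> 2"
    if g: "g \<in> carrier G" "g' \<in> carrier G" for g g'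
  proof -
    note pts = fY[OF vX[OF g(1)]] fY[OF vX[OF g(2)]] vY[OF \<phi>(1)[OF g(1)]] vY[OF \<phi>(1)[OF g(2)]]
    show ?thesis
      using \<phi>(2)[OF g(1)] \<phi>(2)[OF g(2)]
        Y.triangle[OF pts(1,3,2)] Y.triangle[OF pts(3,4,2)]
        Y.triangle[OF pts(3,1,4)] Y.triangle[OF pts(1,2,4)]
        Y.commute[of "vertex (\<phi> g)" "f (vertex g)"] Y.commute[of "vertex (\<phi> g')" "f (vertex g')"]
      by linarith
  qed
  have ctrl: "\<exists>F'. finite F' \<and> F' \<subseteq> carrier H \<and>
        (\<forall>g\<in>carrier G. \<forall>g'\<in>carrier G. inv\<^bsub>G\<^esub> g \<otimes>\<^bsub>G\<^esub> g' \<in> F \<longrightarrow> inv\<^bsub>H\<^esub> (\<phi> g) \<otimes>\<^bsub>H\<^esub> \<phi> g' \<in> F')"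
    if F: "finite F" "F \<subseteq> carrier G" for F
  proof -
    \<comment> \<open>The upper bound turns distance \<open>M\<close> into \<open>n * M + n\<close>;
      the further 2 is the rounding error from \<open>close\<close>.\<close>
    obtain M where M: "F \<subseteq> G.gball S M" using G.finite_subset_gball[OF S(2) F] by blast
    have "inv\<^bsub>H\<^esub> (\<phi> g) \<otimes>\<^bsub>H\<^esub> \<phi> g' \<in> H.gball T (n * M + n + 2)"
      if g: "g \<in> carrier G" "g' \<in> carrier G" "inv\<^bsub>G\<^esub> g \<otimes>\<^bsub>G\<^esub> g' \<in> F" for g g'
    proof (rule H.gball_of_cayley_dist[OF T(2)])
      have "g \<otimes>\<^bsub>G\<^esub> (inv\<^bsub>G\<^esub> g \<otimes>\<^bsub>G\<^esub> g') = g'" using g by (simp add: G.m_assoc[symmetric])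
      then have "?dX (vertex g) (vertex g') \<le> M"
        using G.cayley_dist_vertex_le[OF S(2) g(1), of "inv\<^bsub>G\<^esub> g \<otimes>\<^bsub>G\<^esub> g'" M] M g by auto
      then have "real n * ?dX (vertex g) (vertex g') \<le> real n * M" by (intro mult_left_mono) auto
      then show "?dY (vertex (\<phi> g)) (vertex (\<phi> g')) \<le> real (n * M + n + 2)"
        using upper[OF vX[OF g(1)] vX[OF g(2)]] close[OF g(1,2)] by simp
    qed (use \<phi> g in auto)
    then show ?thesis
      using H.finite_gball[OF T(1)] H.gball_closed[OF TH]
      by (intro exI[of _ "H.gball T (n * M + n + 2)"] conjI ballI impI)
  qed
  have proper: "\<exists>F'. finite F' \<and> F' \<subseteq> carrier G \<and>
        (\<forall>g\<in>carrier G. \<forall>g'\<in>carrier G. inv\<^bsub>H\<^esub> (\<phi> g) \<otimes>\<^bsub>H\<^esub> \<phi> g' \<in> F \<longrightarrow> inv\<^bsub>G\<^esub> g \<otimes>\<^bsub>G\<^esub> g' \<in> F')"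
    if F: "finite F" "F \<subseteq> carrier H" for F
  proof -
    \<comment> \<open>The lower bound, solved for the distance in \<open>G\<close>, turns
      \<open>M\<close> plus the rounding error 2 into \<open>n * (M + 2 + n)\<close>.\<close>
    obtain M where M: "F \<subseteq> H.gball T M" using H.finite_subset_gball[OF T(2) F] by blast
    have "inv\<^bsub>G\<^esub> g \<otimes>\<^bsub>G\<^esub> g' \<in> G.gball S (n * (M + 2 + n))"
      if g: "g \<in> carrier G" "g' \<in> carrier G" "inv\<^bsub>H\<^esub> (\<phi> g) \<otimes>\<^bsub>H\<^esub> \<phi> g' \<in> F" for g g'
    proof (rule G.gball_of_cayley_dist[OF S(2) g(1,2)])
      have "\<phi> g \<otimes>\<^bsub>H\<^esub> (inv\<^bsub>H\<^esub> (\<phi> g) \<otimes>\<^bsub>H\<^esub> \<phi> g') = \<phi> g'"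
        using \<phi>(1)[OF g(1)] \<phi>(1)[OF g(2)] by (simp add: H.m_assoc[symmetric])
      then have "?dY (vertex (\<phi> g)) (vertex (\<phi> g')) \<le> M"
        using H.cayley_dist_vertex_le[OF T(2) \<phi>(1)[OF g(1)], of "inv\<^bsub>H\<^esub> (\<phi> g) \<otimes>\<^bsub>H\<^esub> \<phi> g'" M] M g by auto
      then have "?dY (f (vertex g)) (f (vertex g')) + n \<le> M + 2 + n"
        using close[OF g(1,2)] by linarith
      then have "real n * (?dY (f (vertex g)) (f (vertex g')) + n) \<le> real n * (M + 2 + n)"
        by (intro mult_left_mono) auto
      then show "?dX (vertex g) (vertex g') \<le> real (n * (M + 2 + n))"
        using order_trans[OF lower[OF vX[OF g(1)] vX[OF g(2)]]] by (simp only: of_nat_mult)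
    qed
    then show ?thesis
      using G.finite_gball[OF S(1)] G.gball_closed[OF SG]
      by (intro exI[of _ "G.gball S (n * (M + 2 + n))"] conjI ballI impI)
  qed
  \<comment> \<open>The radius is made up of \<open>n\<close> from quasi-surjectivity,
    \<open>2 * n\<close> for the effect on \<open>f\<close> of moving \<open>x\<close> to a vertex,
    and 1 for rounding the image.\<close>
  have onto: "\<exists>g\<in>carrier G. inv\<^bsub>H\<^esub> (\<phi> g) \<otimes>\<^bsub>H\<^esub> h \<in> H.gball T (3 * n + 1)" if h: "h \<in> carrier H" for h
  proof -
    obtain x where x: "x \<in> ?X" "?dY (f x) (vertex h) \<le> n"
      using surj vY[OF h] by (auto simp: quasi_surjective_def)
    have x': "x \<in> graph_realization (carrier G) (cayley_edges G S)"
      using x by (simp add: cayley_space_def)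
    obtain g where "x g \<noteq> 0" using support_nonempty[OF x'] by blast
    from near_support_vertex[OF G.cayley_edge_subset[OF SG] x' this]
    have g: "g \<in> carrier G" "?dX x (vertex g) \<le> 1" by (auto simp: cayley_dist_def)
    have "real n * ?dX x (vertex g) \<le> real n * 1" using g(2) by (intro mult_left_mono) auto
    then have "?dY (f x) (f (vertex g)) \<le> 2 * n" using upper[OF x(1) vX[OF g(1)]] by simp
    then have "?dY (vertex (\<phi> g)) (vertex h) \<le> real (3 * n + 1)"
      using x(2) \<phi>(2)[OF g(1)] Y.commute[of "f x" "f (vertex g)"]
        Y.commute[of "vertex (\<phi> g)" "f (vertex g)"]
        Y.triangle[OF vY[OF \<phi>(1)[OF g(1)]] fY[OF vX[OF g(1)]] vY[OF h]]
        Y.triangle[OF fY[OF vX[OF g(1)]] fY[OF x(1)] vY[OF h]] by simp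
    then show ?thesis using H.gball_of_cayley_dist[OF T(2) \<phi>(1)[OF g(1)] h] g(1) by blast
  qed
  have "coarse_equivalence G H \<phi>"
    unfolding coarse_equivalence_def
  proof (intro conjI allI impI)
    show "\<phi> \<in> carrier G \<rightarrow> carrier H" using \<phi> by auto
    show "\<exists>F. finite F \<and> F \<subseteq> carrier H \<and> (\<forall>h\<in>carrier H. \<exists>g\<in>carrier G. inv\<^bsub>H\<^esub> (\<phi> g) \<otimes>\<^bsub>H\<^esub> h \<in> F)"
      using H.finite_gball[OF T(1)] H.gball_closed[OF TH] onto
      by (intro exI[of _ "H.gball T (3 * n + 1)"] conjI ballI)
  qed (elim conjE, erule (1) ctrl proper)+
  then show ?thesis by blast
qed

text \<open>A coarse inverse \<open>\<psi>\<close> picks approximate preimages, with error in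
  \<open>K\<close>. The conditions are interchanged: properness of \<open>\<phi>\<close> gives
  control of \<open>\<psi>\<close>, and control of \<open>\<phi>\<close> gives properness of
  \<open>\<psi>\<close>.\<close>

lemma coarse_equivalence_sym:
  assumes "group G" "group H" "coarse_equivalence G H \<phi>"
  shows "\<exists>\<psi>. coarse_equivalence H G \<psi>"
proof -
  interpret G: group G by fact
  interpret H: group H by fact
  have \<phi>: "\<phi> g \<in> carrier H" if "g \<in> carrier G" for g
    using assms(3) that by (auto simp: coarse_equivalence_def)
  have ctrl: "\<And>F. finite F \<Longrightarrow> F \<subseteq> carrier G \<Longrightarrow> \<exists>F'. finite F' \<and> F' \<subseteq> carrier H \<and>
        (\<forall>g\<in>carrier G. \<forall>g'\<in>carrier G. inv\<^bsub>G\<^esub> g \<otimes>\<^bsub>G\<^esub> g' \<in> F \<longrightarrow> inv\<^bsub>H\<^esub> (\<phi> g) \<otimes>\<^bsub>H\<^esub> \<phi> g' \<in> F')"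
    and proper: "\<And>F. finite F \<Longrightarrow> F \<subseteq> carrier H \<Longrightarrow> \<exists>F'. finite F' \<and> F' \<subseteq> carrier G \<and>
        (\<forall>g\<in>carrier G. \<forall>g'\<in>carrier G. inv\<^bsub>H\<^esub> (\<phi> g) \<otimes>\<^bsub>H\<^esub> \<phi> g' \<in> F \<longrightarrow> inv\<^bsub>G\<^esub> g \<otimes>\<^bsub>G\<^esub> g' \<in> F')"
    using assms(3) unfolding coarse_equivalence_def by blast+
  have "\<exists>K. finite K \<and> K \<subseteq> carrier H \<and> (\<forall>h\<in>carrier H. \<exists>g\<in>carrier G. inv\<^bsub>H\<^esub> (\<phi> g) \<otimes>\<^bsub>H\<^esub> h \<in> K)"
    using assms(3) unfolding coarse_equivalence_def by (elim conjE)
  then obtain K where K: "finite K" "K \<subseteq> carrier H"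
    and surj: "\<forall>h\<in>carrier H. \<exists>g\<in>carrier G. inv\<^bsub>H\<^esub> (\<phi> g) \<otimes>\<^bsub>H\<^esub> h \<in> K"
    by (elim exE conjE)
  define \<psi> where "\<psi> h = (SOME g. g \<in> carrier G \<and> inv\<^bsub>H\<^esub> (\<phi> g) \<otimes>\<^bsub>H\<^esub> h \<in> K)" for h
  have \<psi>: "\<psi> h \<in> carrier G" "inv\<^bsub>H\<^esub> (\<phi> (\<psi> h)) \<otimes>\<^bsub>H\<^esub> h \<in> K" if "h \<in> carrier H" for h
    using someI_ex[of "\<lambda>g. g \<in> carrier G \<and> inv\<^bsub>H\<^esub> (\<phi> g) \<otimes>\<^bsub>H\<^esub> h \<in> K"] surj that
    unfolding \<psi>_def by auto
  have 1: "\<exists>F'. finite F' \<and> F' \<subseteq> carrier G \<and>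
        (\<forall>h\<in>carrier H. \<forall>h'\<in>carrier H. inv\<^bsub>H\<^esub> h \<otimes>\<^bsub>H\<^esub> h' \<in> F \<longrightarrow> inv\<^bsub>G\<^esub> (\<psi> h) \<otimes>\<^bsub>G\<^esub> \<psi> h' \<in> F')"
    if F: "finite F" "F \<subseteq> carrier H" for F
  proof -
    \<comment> \<open>Passing from \<open>\<phi> (\<psi> h)\<close> to \<open>h\<close>, then to
      \<open>h'\<close>, then to \<open>\<phi> (\<psi> h')\<close> contributes one factor
      each.\<close>
    let ?F = "(\<lambda>(a, b, c). a \<otimes>\<^bsub>H\<^esub> b \<otimes>\<^bsub>H\<^esub> inv\<^bsub>H\<^esub> c) ` (K \<times> F \<times> K)"
    have "inv\<^bsub>H\<^esub> (\<phi> (\<psi> h)) \<otimes>\<^bsub>H\<^esub> \<phi> (\<psi> h') \<in> ?F"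
      if h: "h \<in> carrier H" "h' \<in> carrier H" "inv\<^bsub>H\<^esub> h \<otimes>\<^bsub>H\<^esub> h' \<in> F" for h h'
    proof -
      let ?a = "inv\<^bsub>H\<^esub> (\<phi> (\<psi> h)) \<otimes>\<^bsub>H\<^esub> h" and ?c = "inv\<^bsub>H\<^esub> (\<phi> (\<psi> h')) \<otimes>\<^bsub>H\<^esub> h'"
      have "inv\<^bsub>H\<^esub> (\<phi> (\<psi> h)) \<otimes>\<^bsub>H\<^esub> \<phi> (\<psi> h') = ?a \<otimes>\<^bsub>H\<^esub> (inv\<^bsub>H\<^esub> h \<otimes>\<^bsub>H\<^esub> h') \<otimes>\<^bsub>H\<^esub> inv\<^bsub>H\<^esub> ?c"
        using h \<phi>[OF \<psi>(1)[OF h(1)]] \<phi>[OF \<psi>(1)[OF h(2)]]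
        by (simp add: H.inv_mult_group H.m_assoc H.mult_inv_cancel H.inv_mult_cancel)
      then show ?thesis using \<psi>(2)[OF h(1)] \<psi>(2)[OF h(2)] h(3) by force
    qed
    note F' = this
    have "finite ?F" "?F \<subseteq> carrier H" using F K by auto
    from proper[OF this] obtain E where E: "finite E" "E \<subseteq> carrier G" "\<forall>g\<in>carrier G. \<forall>g'\<in>carrier G.
        inv\<^bsub>H\<^esub> (\<phi> g) \<otimes>\<^bsub>H\<^esub> \<phi> g' \<in> ?F \<longrightarrow> inv\<^bsub>G\<^esub> g \<otimes>\<^bsub>G\<^esub> g' \<in> E"
      by (elim exE conjE)
    have "inv\<^bsub>G\<^esub> (\<psi> h) \<otimes>\<^bsub>G\<^esub> \<psi> h' \<in> E"
      if "h \<in> carrier H" "h' \<in> carrier H" "inv\<^bsub>H\<^esub> h \<otimes>\<^bsub>H\<^esub> h' \<in> F" for h h'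
      using E(3)[rule_format, OF \<psi>(1)[OF that(1)] \<psi>(1)[OF that(2)] F'[OF that]] .
    then show ?thesis using E(1,2) by (intro exI[of _ E] conjI ballI impI)
  qed
  have 2: "\<exists>F'. finite F' \<and> F' \<subseteq> carrier H \<and>
        (\<forall>h\<in>carrier H. \<forall>h'\<in>carrier H. inv\<^bsub>G\<^esub> (\<psi> h) \<otimes>\<^bsub>G\<^esub> \<psi> h' \<in> F \<longrightarrow> inv\<^bsub>H\<^esub> h \<otimes>\<^bsub>H\<^esub> h' \<in> F')"
    if F: "finite F" "F \<subseteq> carrier G" for F
  proof -
    obtain F' where F': "finite F'" "F' \<subseteq> carrier H" "\<forall>g\<in>carrier G. \<forall>g'\<in>carrier G.
        inv\<^bsub>G\<^esub> g \<otimes>\<^bsub>G\<^esub> g' \<in> F \<longrightarrow> inv\<^bsub>H\<^esub> (\<phi> g) \<otimes>\<^bsub>H\<^esub> \<phi> g' \<in> F'"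
      using ctrl[OF F] by blast
    let ?F = "(\<lambda>(a, b, c). inv\<^bsub>H\<^esub> a \<otimes>\<^bsub>H\<^esub> b \<otimes>\<^bsub>H\<^esub> c) ` (K \<times> F' \<times> K)"
    have "inv\<^bsub>H\<^esub> h \<otimes>\<^bsub>H\<^esub> h' \<in> ?F"
      if h: "h \<in> carrier H" "h' \<in> carrier H" "inv\<^bsub>G\<^esub> (\<psi> h) \<otimes>\<^bsub>G\<^esub> \<psi> h' \<in> F" for h h'
    proof -
      let ?a = "inv\<^bsub>H\<^esub> (\<phi> (\<psi> h)) \<otimes>\<^bsub>H\<^esub> h" and ?c = "inv\<^bsub>H\<^esub> (\<phi> (\<psi> h')) \<otimes>\<^bsub>H\<^esub> h'"
      have "inv\<^bsub>H\<^esub> h \<otimes>\<^bsub>H\<^esub> h' = inv\<^bsub>H\<^esub> ?a \<otimes>\<^bsub>H\<^esub> (inv\<^bsub>H\<^esub> (\<phi> (\<psi> h)) \<otimes>\<^bsub>H\<^esub> \<phi> (\<psi> h')) \<otimes>\<^bsub>H\<^esub> ?c"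
        using h \<phi>[OF \<psi>(1)[OF h(1)]] \<phi>[OF \<psi>(1)[OF h(2)]]
        by (simp add: H.inv_mult_group H.m_assoc H.mult_inv_cancel H.inv_mult_cancel)
      moreover have "inv\<^bsub>H\<^esub> (\<phi> (\<psi> h)) \<otimes>\<^bsub>H\<^esub> \<phi> (\<psi> h') \<in> F'" using F'(3) \<psi>(1) h by blast
      ultimately show ?thesis using \<psi>(2)[OF h(1)] \<psi>(2)[OF h(2)] by force
    qed
    moreover have "finite ?F" "?F \<subseteq> carrier H"
      using F'(1,2) K by (auto simp: subset_iff)
    ultimately show ?thesis by (intro exI[of _ ?F] conjI ballI impI)
  qed
  \<comment> \<open>Since \<open>\<phi> (\<psi> (\<phi> g))\<close> and \<open>\<phi> g\<close>
    differ by an element of \<open>K\<close>, properness bounds the difference of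
    \<open>\<psi> (\<phi> g)\<close> and \<open>g\<close>. This gives coarse surjectivity of
    \<open>\<psi>\<close>.\<close>
  obtain E where E: "finite E" "E \<subseteq> carrier G" "\<forall>g\<in>carrier G. \<forall>g'\<in>carrier G.
        inv\<^bsub>H\<^esub> (\<phi> g) \<otimes>\<^bsub>H\<^esub> \<phi> g' \<in> K \<longrightarrow> inv\<^bsub>G\<^esub> g \<otimes>\<^bsub>G\<^esub> g' \<in> E"
    using proper[OF K] by (elim exE conjE)
  have "inv\<^bsub>G\<^esub> (\<psi> (\<phi> g)) \<otimes>\<^bsub>G\<^esub> g \<in> E" if "g \<in> carrier G" for g
    using E(3)[rule_format, OF \<psi>(1)[OF \<phi>[OF that]] that \<psi>(2)[OF \<phi>[OF that]]] .
  then have "\<exists>h\<in>carrier H. inv\<^bsub>G\<^esub> (\<psi> h) \<otimes>\<^bsub>G\<^esub> g \<in> E" if "g \<in> carrier G" for g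
    using \<phi> that by blast
  then have 3: "\<exists>E. finite E \<and> E \<subseteq> carrier G \<and> (\<forall>g\<in>carrier G. \<exists>h\<in>carrier H. inv\<^bsub>G\<^esub> (\<psi> h) \<otimes>\<^bsub>G\<^esub> g \<in> E)"
    using E(1,2) by (intro exI[of _ E] conjI ballI)
  have "coarse_equivalence H G \<psi>"
    unfolding coarse_equivalence_def
  proof (intro conjI allI impI)
    show "\<psi> \<in> carrier H \<rightarrow> carrier G" using \<psi> by auto
  qed (rule 3 | elim conjE, erule (1) 1 2)+
  then show ?thesis by blast
qed

section \<open>Pulling back a subshift along a coarse equivalence\<close>

text \<open>The step \<open>s\<close> in \<open>close\<close> covers three cases:
  \<open>\<one>\<close> bounds fibres, letters give path lifting, and elements of \<open>S\<close>
  make the rule of \<open>\<Xi>\<close> visible locally. The radius \<open>N\<close> is large enough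
  for relators and cancelling pairs of \<open>H\<close> to fit into a ball, and for the lifting
  estimates of a coarse covering.\<close>

locale SFT_pullback =
  H: group_presentation H Y Q evH + G: group_presentation G X R ev
  for H :: "('b, 'd) monoid_scheme" and Y :: "'y set" and Q evH
    and G :: "('a, 'c) monoid_scheme" and X :: "'x set" and R ev +
  fixes \<phi>0 :: "'b \<Rightarrow> 'a" and F V S :: "'a set" and m N :: nat
    and A :: "'s set" and L :: "('a \<Rightarrow> 's) set" and \<Xi> :: "('a \<Rightarrow> 's) set"
  assumes \<phi>0_closed [simp]: "h \<in> carrier H \<Longrightarrow> \<phi>0 h \<in> carrier G"
    and F: "finite F" "F \<subseteq> carrier G" "\<one>\<^bsub>G\<^esub> \<in> F"
    and onto: "g \<in> carrier G \<Longrightarrow> \<exists>h\<in>carrier H. \<exists>a\<in>F. g = \<phi>0 h \<otimes>\<^bsub>G\<^esub> a"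
    and close: "\<lbrakk>k \<in> carrier H; k' \<in> carrier H; a \<in> F; a' \<in> F;
      s \<in> insert \<one>\<^bsub>G\<^esub> (S \<union> (\<lambda>l. ev [l]) ` (X \<times> UNIV)); \<phi>0 k \<otimes>\<^bsub>G\<^esub> a \<otimes>\<^bsub>G\<^esub> s = \<phi>0 k' \<otimes>\<^bsub>G\<^esub> a'\<rbrakk>
      \<Longrightarrow> inv\<^bsub>H\<^esub> k \<otimes>\<^bsub>H\<^esub> k' \<in> H.wball m"
    and N_ge: "3 * m \<le> N" "2 \<le> N" "r \<in> R \<Longrightarrow> m * length r \<le> N" "q \<in> Q \<Longrightarrow> length q \<le> N"
    and V: "finite V"
      "\<lbrakk>h \<in> carrier H; y \<in> Y\<rbrakk> \<Longrightarrow> inv\<^bsub>G\<^esub> (\<phi>0 h) \<otimes>\<^bsub>G\<^esub> \<phi>0 (h \<otimes>\<^bsub>H\<^esub> evH [(y, b)]) \<in> V"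
    and short: "v \<in> V \<union> F \<Longrightarrow> \<exists>w\<in>group_words X. m * length w + 1 \<le> N \<and> ev w = v"
    and S: "S \<subseteq> carrier G"
    and A: "finite A"
    and \<Xi>: "\<Xi> = {\<sigma> \<in> carrier G \<rightarrow>\<^sub>E A. \<forall>g\<in>carrier G. restrict (shift G \<sigma> g) S \<in> L}"
begin

lemma \<Xi>_shift: "x \<in> \<Xi> \<Longrightarrow> g \<in> carrier G \<Longrightarrow> shift G x g \<in> \<Xi>"
  unfolding \<Xi> by (simp add: G.shift_shift G.shift_in_PiE)

definition symbol :: "('a \<Rightarrow> 's) \<Rightarrow> 'b \<Rightarrow> ('y \<times> bool \<Rightarrow> 'a) \<times> ('a \<Rightarrow> 's)" where
  "symbol x h = ((\<lambda>l\<in>Y \<times> UNIV. inv\<^bsub>G\<^esub> (\<phi>0 h) \<otimes>\<^bsub>G\<^esub> \<phi>0 (h \<otimes>\<^bsub>H\<^esub> evH [l])),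
                 (\<lambda>a\<in>F. x (\<phi>0 h \<otimes>\<^bsub>G\<^esub> a)))"

definition alphabet :: "(('y \<times> bool \<Rightarrow> 'a) \<times> ('a \<Rightarrow> 's)) set" where
  "alphabet = ((Y \<times> UNIV) \<rightarrow>\<^sub>E V) \<times> (F \<rightarrow>\<^sub>E A)"

text \<open>Both \<open>k\<close> and \<open>x\<close> may vary from ball to ball, so global
  consistency is not built in and has to be derived.\<close>

definition pullback_rule :: "('b \<Rightarrow> ('y \<times> bool \<Rightarrow> 'a) \<times> ('a \<Rightarrow> 's)) \<Rightarrow> bool" where
  "pullback_rule y \<longleftrightarrow> (\<exists>k\<in>carrier H. \<exists>x\<in>\<Xi>. \<forall>u\<in>H.wball N. y u = symbol x (k \<otimes>\<^bsub>H\<^esub> u))"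

lemma finite_alphabet: "finite alphabet"
  unfolding alphabet_def using H.finite_generators F V A
  by (intro finite_cartesian_product finite_PiE) auto

lemma symbol_in_alphabet:
  assumes "x \<in> \<Xi>" "h \<in> carrier H"
  shows "symbol x h \<in> alphabet"
proof -
  have "x (\<phi>0 h \<otimes>\<^bsub>G\<^esub> a) \<in> A" if "a \<in> F" for a
    using assms that F by (auto simp: \<Xi> PiE_def Pi_iff)
  then show ?thesis using assms V by (auto simp: alphabet_def symbol_def)
qed

lemma pullback_rule_symbol:
  assumes "x \<in> \<Xi>" "g \<in> carrier H"
  shows "pullback_rule (\<lambda>k. symbol x (g \<otimes>\<^bsub>H\<^esub> k))"
  using assms by (auto simp: pullback_rule_def)

section \<open>Integrating a configuration that obeys the rule\<close>

context
  fixes y :: "'b \<Rightarrow> ('y \<times> bool \<Rightarrow> 'a) \<times> ('a \<Rightarrow> 's)"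
  assumes y: "y \<in> carrier H \<rightarrow> alphabet"
    and y_rule: "\<And>h. h \<in> carrier H \<Longrightarrow> pullback_rule (\<lambda>k. y (h \<otimes>\<^bsub>H\<^esub> k))"
begin

text \<open>A discrete path integral: the first component accumulates the increments recorded by
  \<open>y\<close> along a path in \<open>H\<close>.\<close>

definition step :: "'a \<times> 'b \<Rightarrow> 'y \<times> bool \<Rightarrow> 'a \<times> 'b" where
  "step e l = (fst e \<otimes>\<^bsub>G\<^esub> fst (y (snd e)) l, snd e \<otimes>\<^bsub>H\<^esub> evH [l])"

lemma local_form:
  assumes "h \<in> carrier H"
  obtains k x where "k \<in> carrier H" "x \<in> \<Xi>"
    "\<And>u. u \<in> H.wball N \<Longrightarrow> y (h \<otimes>\<^bsub>H\<^esub> u) = symbol x (k \<otimes>\<^bsub>H\<^esub> u)"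
  using y_rule[OF assms] unfolding pullback_rule_def by blast

lemma derivative_closed:
  assumes "h \<in> carrier H" "v \<in> Y"
  shows "fst (y h) (v, b) \<in> carrier G"
proof -
  obtain k x where k: "k \<in> carrier H" "y (h \<otimes>\<^bsub>H\<^esub> \<one>\<^bsub>H\<^esub>) = symbol x (k \<otimes>\<^bsub>H\<^esub> \<one>\<^bsub>H\<^esub>)"
    using local_form[OF assms(1)] H.one_in_wball by metis
  then show ?thesis using assms by (simp add: symbol_def)
qed

lemma foldl_step_closed:
  assumes "e \<in> carrier G \<times> carrier H" "w \<in> group_words Y"
  shows "foldl step e w \<in> carrier G \<times> carrier H \<and> snd (foldl step e w) = snd e \<otimes>\<^bsub>H\<^esub> evH w"
  using assms(2)
proof (induction w rule: rev_induct)
  case Nil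
  then show ?case using assms by auto
next
  case (snoc l w)
  then show ?case
    using assms derivative_closed by (cases l) (auto simp: step_def H.ev_append H.m_assoc)
qed

text \<open>All prefixes of \<open>w\<close> stay in a ball on which the increments of
  \<open>y\<close> are those of \<open>\<phi>0\<close>, so their product telescopes.\<close>

lemma foldl_step_short:
  assumes g: "g \<in> carrier G" and h: "h \<in> carrier H" and k: "k \<in> carrier H"
    and loc: "\<And>u. u \<in> H.wball N \<Longrightarrow> y (h \<otimes>\<^bsub>H\<^esub> u) = symbol x (k \<otimes>\<^bsub>H\<^esub> u)"
    and w: "w \<in> group_words Y" "length w \<le> N"
  shows "foldl step (g, h) w
    = (g \<otimes>\<^bsub>G\<^esub> (inv\<^bsub>G\<^esub> (\<phi>0 k) \<otimes>\<^bsub>G\<^esub> \<phi>0 (k \<otimes>\<^bsub>H\<^esub> evH w)), h \<otimes>\<^bsub>H\<^esub> evH w)"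
  using w
proof (induction w rule: rev_induct)
  case Nil
  then show ?case using g h k by simp
next
  case (snoc l w)
  obtain v b where l: "l = (v, b)" by fastforce
  have w: "w \<in> group_words Y" "length w \<le> N" "v \<in> Y" using snoc by (auto simp: l)
  have "evH w \<in> H.wball N" using w by (auto simp: H.wball_def)
  from loc[OF this] have "fst (y (h \<otimes>\<^bsub>H\<^esub> evH w)) l
    = inv\<^bsub>G\<^esub> (\<phi>0 (k \<otimes>\<^bsub>H\<^esub> evH w)) \<otimes>\<^bsub>G\<^esub> \<phi>0 (k \<otimes>\<^bsub>H\<^esub> evH w \<otimes>\<^bsub>H\<^esub> evH [l])"
    using w by (simp add: symbol_def l)
  then show ?case
    using snoc.IH[OF w(1,2)] w g h k
    by (simp add: step_def l H.ev_append H.m_assoc G.m_assoc G.mult_inv_cancel)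
qed

text \<open>Path independence. Relators and cancelling pairs of \<open>H\<close> have length at most
  \<open>N\<close>, so by telescoping the integral along them is trivial, and every relation of
  \<open>H\<close> is a consequence of these.\<close>

lemma foldl_step_eq:
  assumes e: "e \<in> carrier G \<times> carrier H"
    and vw: "v \<in> group_words Y" "w \<in> group_words Y" "evH v = evH w"
  shows "foldl step e v = foldl step e w"
proof -
  have short: "foldl step e r = e"
    if e: "e \<in> carrier G \<times> carrier H" and r: "r \<in> group_words Y" "length r \<le> N" "evH r = \<one>\<^bsub>H\<^esub>" for e r
  proof -
    obtain g h where gh: "e = (g, h)" "g \<in> carrier G" "h \<in> carrier H" using e by blast
    obtain k x where k: "k \<in> carrier H"
      "\<And>u. u \<in> H.wball N \<Longrightarrow> y (h \<otimes>\<^bsub>H\<^esub> u) = symbol x (k \<otimes>\<^bsub>H\<^esub> u)"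
      using local_form[OF gh(3)] by metis
    show ?thesis using foldl_step_short[OF gh(2,3) k r(1,2)] gh k r by simp
  qed
  have "(foldl step e v, foldl step e w) \<in> Id_on (carrier G \<times> carrier H)"
  proof (rule foldl_presentation_rel[OF _ H.relators_words _ _ _ _ _ e])
    show "(v, w) \<in> presentation_rel Y Q" using vw H.ev_eq_iff by blast
    show closed: "step e (v, b) \<in> carrier G \<times> carrier H"
      if "e \<in> carrier G \<times> carrier H" "v \<in> Y" for e v b
      using foldl_step_closed[OF that(1), of "[(v, b)]"] that by simp
    show "equiv (carrier G \<times> carrier H) (Id_on (carrier G \<times> carrier H))"
      by (auto intro!: equivI simp: refl_on_def sym_def trans_def)
    show "(step e (v, b), step e' (v, b)) \<in> Id_on (carrier G \<times> carrier H)"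
      if "(e, e') \<in> Id_on (carrier G \<times> carrier H)" "v \<in> Y" for e e' v b
      using that closed by auto
    show "(step (step e (v, b)) (v, \<not> b), e) \<in> Id_on (carrier G \<times> carrier H)"
      if "e \<in> carrier G \<times> carrier H" "v \<in> Y" for e v b
      using short[OF that(1), of "[(v, b), (v, \<not> b)]"] that N_ge(2)
        H.ev_append[of "[(v, b)]" "[(v, \<not> b)]"] H.ev_cancel by (simp add: Id_onI)
    show "(foldl step e q, e) \<in> Id_on (carrier G \<times> carrier H)"
      if "e \<in> carrier G \<times> carrier H" "q \<in> Q" for e q
      using short[OF that(1), of q] that N_ge(4) H.relators_words H.ev_relator by auto
  qed
  then show ?thesis by auto
qed

text \<open>The primitive of the increments with value \<open>\<one>\<close> at
  \<open>\<one>\<close>; by \<open>foldl_step_eq\<close> it is the same for every choice of the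
  word.\<close>

definition integral_map :: "'b \<Rightarrow> 'a" where
  "integral_map h = fst (foldl step (\<one>\<^bsub>G\<^esub>, \<one>\<^bsub>H\<^esub>) (SOME w. w \<in> group_words Y \<and> evH w = h))"

lemma foldl_step_integral_map:
  assumes "w \<in> group_words Y"
  shows "foldl step (\<one>\<^bsub>G\<^esub>, \<one>\<^bsub>H\<^esub>) w = (integral_map (evH w), evH w)"
proof -
  define v where "v = (SOME v. v \<in> group_words Y \<and> evH v = evH w)"
  have "v \<in> group_words Y \<and> evH v = evH w"
    unfolding v_def by (rule someI[of _ w]) (simp add: assms)
  then have "foldl step (\<one>\<^bsub>G\<^esub>, \<one>\<^bsub>H\<^esub>) v = foldl step (\<one>\<^bsub>G\<^esub>, \<one>\<^bsub>H\<^esub>) w"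
    using assms by (intro foldl_step_eq) auto
  moreover have "integral_map (evH w) = fst (foldl step (\<one>\<^bsub>G\<^esub>, \<one>\<^bsub>H\<^esub>) v)"
    unfolding integral_map_def v_def ..
  moreover have "snd (foldl step (\<one>\<^bsub>G\<^esub>, \<one>\<^bsub>H\<^esub>) w) = evH w"
    using foldl_step_closed[of "(\<one>\<^bsub>G\<^esub>, \<one>\<^bsub>H\<^esub>)" w] assms by simp
  ultimately show ?thesis by (simp add: prod_eq_iff)
qed

lemma integral_map_closed:
  assumes "h \<in> carrier H"
  shows "integral_map h \<in> carrier G"
proof -
  obtain w where "w \<in> group_words Y" "evH w = h" using H.ev_surj assms by blast
  then show ?thesis
    using foldl_step_closed[of "(\<one>\<^bsub>G\<^esub>, \<one>\<^bsub>H\<^esub>)" w] foldl_step_integral_map by auto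
qed

lemma integral_map_one: "integral_map \<one>\<^bsub>H\<^esub> = \<one>\<^bsub>G\<^esub>"
  using foldl_step_integral_map[of "[]"] by simp

lemma foldl_step_base:
  assumes "h \<in> carrier H" "w \<in> group_words Y"
  shows "foldl step (integral_map h, h) w = (integral_map (h \<otimes>\<^bsub>H\<^esub> evH w), h \<otimes>\<^bsub>H\<^esub> evH w)"
proof -
  obtain v where v: "v \<in> group_words Y" "evH v = h" using H.ev_surj assms by blast
  have "foldl step (integral_map h, h) w = foldl step (\<one>\<^bsub>G\<^esub>, \<one>\<^bsub>H\<^esub>) (v @ w)"
    using foldl_step_integral_map[OF v(1)] v by simp
  then show ?thesis using foldl_step_integral_map[of "v @ w"] v assms by (simp add: H.ev_append)
qed

lemma integral_map_letter:
  assumes "h \<in> carrier H" "v \<in> Y"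
  shows "integral_map (h \<otimes>\<^bsub>H\<^esub> evH [(v, b)]) = integral_map h \<otimes>\<^bsub>G\<^esub> fst (y h) (v, b)"
  using foldl_step_base[OF assms(1), of "[(v, b)]"] assms by (simp add: step_def)

text \<open>On each ball of radius \<open>N\<close> the integral is a left translate of
  \<open>\<phi>0\<close>. Translating the local model in \<open>\<Xi>\<close> accordingly lets the
  symbols be read at points of \<open>integral_map\<close> itself.\<close>

lemma integral_map_local:
  assumes h: "h \<in> carrier H"
  obtains c k x where "c \<in> carrier G" "k \<in> carrier H" "x \<in> \<Xi>"
    "\<And>u. u \<in> H.wball N \<Longrightarrow> integral_map (h \<otimes>\<^bsub>H\<^esub> u) = c \<otimes>\<^bsub>G\<^esub> \<phi>0 (k \<otimes>\<^bsub>H\<^esub> u)"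
    "\<And>u a. u \<in> H.wball N \<Longrightarrow> a \<in> F \<Longrightarrow> snd (y (h \<otimes>\<^bsub>H\<^esub> u)) a = x (integral_map (h \<otimes>\<^bsub>H\<^esub> u) \<otimes>\<^bsub>G\<^esub> a)"
proof -
  obtain k x where k: "k \<in> carrier H" and x: "x \<in> \<Xi>"
    and loc: "\<And>u. u \<in> H.wball N \<Longrightarrow> y (h \<otimes>\<^bsub>H\<^esub> u) = symbol x (k \<otimes>\<^bsub>H\<^esub> u)"
    using local_form[OF h] by metis
  \<comment> \<open>The translation that makes the two maps agree at \<open>h\<close>.\<close>
  define c where "c = integral_map h \<otimes>\<^bsub>G\<^esub> inv\<^bsub>G\<^esub> (\<phi>0 k)"
  have c: "c \<in> carrier G" using k h by (simp add: c_def integral_map_closed)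
  have map: "integral_map (h \<otimes>\<^bsub>H\<^esub> u) = c \<otimes>\<^bsub>G\<^esub> \<phi>0 (k \<otimes>\<^bsub>H\<^esub> u)" if u: "u \<in> H.wball N" for u
  proof -
    obtain w where w: "w \<in> group_words Y" "length w \<le> N" "u = evH w"
      using u by (auto simp: H.wball_def)
    show ?thesis
      using foldl_step_short[OF integral_map_closed[OF h] h k loc w(1,2)] foldl_step_base[OF h w(1)] w h k
      by (simp add: c_def G.m_assoc integral_map_closed)
  qed
  \<comment> \<open>The model is shifted by the inverse of \<open>c\<close>, which cancels the
    translation between \<open>\<phi>0\<close> and the integral.\<close>
  have "snd (y (h \<otimes>\<^bsub>H\<^esub> u)) a = shift G x (inv\<^bsub>G\<^esub> c) (integral_map (h \<otimes>\<^bsub>H\<^esub> u) \<otimes>\<^bsub>G\<^esub> a)"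
    if u: "u \<in> H.wball N" and a: "a \<in> F" for u a
  proof -
    have carr: "u \<in> carrier H" "a \<in> carrier G" using u a F by auto
    have "inv\<^bsub>G\<^esub> c \<otimes>\<^bsub>G\<^esub> (integral_map (h \<otimes>\<^bsub>H\<^esub> u) \<otimes>\<^bsub>G\<^esub> a) = \<phi>0 (k \<otimes>\<^bsub>H\<^esub> u) \<otimes>\<^bsub>G\<^esub> a"
      unfolding map[OF u] using c k carr by (simp add: G.m_assoc G.inv_mult_cancel)
    then show ?thesis
      using loc[OF u] a carr h by (simp add: G.shift_apply symbol_def integral_map_closed)
  qed
  with c k x map \<Xi>_shift show ?thesis by (intro that[of c k "shift G x (inv\<^bsub>G\<^esub> c)"]) auto
qed

text \<open>The point is translated to the model, lifted there by \<open>onto\<close>, and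
  translated back. By \<open>close\<close> the lift is within \<open>m \<le> N\<close>, where the
  translate of \<open>\<phi>0\<close> still describes the integral.\<close>

lemma integral_map_lift:
  assumes h: "h \<in> carrier H" and a: "a \<in> F"
    and s: "s \<in> S \<union> (\<lambda>l. ev [l]) ` (X \<times> UNIV)"
  shows "\<exists>u\<in>H.wball m. \<exists>a'\<in>F.
    integral_map h \<otimes>\<^bsub>G\<^esub> a \<otimes>\<^bsub>G\<^esub> s = integral_map (h \<otimes>\<^bsub>H\<^esub> u) \<otimes>\<^bsub>G\<^esub> a'"
proof -
  obtain c k x where k: "c \<in> carrier G" "k \<in> carrier H"
    "\<And>u. u \<in> H.wball N \<Longrightarrow> integral_map (h \<otimes>\<^bsub>H\<^esub> u) = c \<otimes>\<^bsub>G\<^esub> \<phi>0 (k \<otimes>\<^bsub>H\<^esub> u)"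
    using integral_map_local[OF h] by metis
  have carr: "a \<in> carrier G" "s \<in> carrier G" using a s F S by auto
  obtain k' a' where k': "k' \<in> carrier H" "a' \<in> F" "\<phi>0 k \<otimes>\<^bsub>G\<^esub> a \<otimes>\<^bsub>G\<^esub> s = \<phi>0 k' \<otimes>\<^bsub>G\<^esub> a'"
    using onto[of "\<phi>0 k \<otimes>\<^bsub>G\<^esub> a \<otimes>\<^bsub>G\<^esub> s"] k carr by auto
  define u where "u = inv\<^bsub>H\<^esub> k \<otimes>\<^bsub>H\<^esub> k'"
  have u: "u \<in> H.wball m"
    unfolding u_def using close[OF k(2) k'(1) a k'(2) _ k'(3)] s by blast
  then have uN: "u \<in> H.wball N" using N_ge(1) H.wball_mono by simp
  have "integral_map h = c \<otimes>\<^bsub>G\<^esub> \<phi>0 k" using k(3)[of "\<one>\<^bsub>H\<^esub>"] h k by simp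
  then have "integral_map h \<otimes>\<^bsub>G\<^esub> a \<otimes>\<^bsub>G\<^esub> s = c \<otimes>\<^bsub>G\<^esub> (\<phi>0 k \<otimes>\<^bsub>G\<^esub> a \<otimes>\<^bsub>G\<^esub> s)"
    using k carr by (simp add: G.m_assoc)
  also have "\<dots> = integral_map (h \<otimes>\<^bsub>H\<^esub> u) \<otimes>\<^bsub>G\<^esub> a'"
  proof -
    have "k \<otimes>\<^bsub>H\<^esub> u = k'" using k k' by (simp add: u_def H.mult_inv_cancel)
    then show ?thesis using k(1) k' F by (simp add: k(3)[OF uN] G.m_assoc subset_iff)
  qed
  finally show ?thesis using u k' by blast
qed

text \<open>All the conditions on fibres and lifts are local, and the equations in them survive left
  translation, so they are inherited from \<open>\<phi>0\<close>.\<close>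

lemma coarse_covering_integral_map: "coarse_covering H Y Q evH G X R ev integral_map F m N"
proof unfold_locales
  show "u \<in> H.wball m"
    if h: "h \<in> carrier H" and u: "u \<in> H.wball N" and a: "a \<in> F" "a' \<in> F"
      and eq: "integral_map h \<otimes>\<^bsub>G\<^esub> a = integral_map (h \<otimes>\<^bsub>H\<^esub> u) \<otimes>\<^bsub>G\<^esub> a'" for h u a a'
  proof -
    obtain c k x where k: "c \<in> carrier G" "k \<in> carrier H"
      "\<And>u. u \<in> H.wball N \<Longrightarrow> integral_map (h \<otimes>\<^bsub>H\<^esub> u) = c \<otimes>\<^bsub>G\<^esub> \<phi>0 (k \<otimes>\<^bsub>H\<^esub> u)"
      using integral_map_local[OF h] by metis
    have carr: "a \<in> carrier G" "a' \<in> carrier G" "u \<in> carrier H" using a F u by auto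
    have "integral_map h = c \<otimes>\<^bsub>G\<^esub> \<phi>0 k" using k(3)[of "\<one>\<^bsub>H\<^esub>"] h k by simp
    then have "c \<otimes>\<^bsub>G\<^esub> (\<phi>0 k \<otimes>\<^bsub>G\<^esub> a) = c \<otimes>\<^bsub>G\<^esub> (\<phi>0 (k \<otimes>\<^bsub>H\<^esub> u) \<otimes>\<^bsub>G\<^esub> a')"
      using eq k(3)[OF u] k carr by (simp add: G.m_assoc)
    \<comment> \<open>The trivial step \<open>\<one>\<close> brings the equation into the form of
      \<open>close\<close>.\<close>
    then have "\<phi>0 k \<otimes>\<^bsub>G\<^esub> a \<otimes>\<^bsub>G\<^esub> \<one>\<^bsub>G\<^esub> = \<phi>0 (k \<otimes>\<^bsub>H\<^esub> u) \<otimes>\<^bsub>G\<^esub> a'"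
      using k carr by simp
    then have "inv\<^bsub>H\<^esub> k \<otimes>\<^bsub>H\<^esub> (k \<otimes>\<^bsub>H\<^esub> u) \<in> H.wball m"
      using close[OF k(2) _ a(1,2) insertI1] k carr by simp
    then show ?thesis using k carr by (simp add: H.inv_mult_cancel)
  qed
  show "\<exists>w\<in>group_words X. m * length w + 1 \<le> N
      \<and> integral_map (h \<otimes>\<^bsub>H\<^esub> evH [(v, b)]) = integral_map h \<otimes>\<^bsub>G\<^esub> ev w"
    if h: "h \<in> carrier H" and v: "v \<in> Y" for h v b
  proof -
    have "fst (y h) (v, b) \<in> V" using y h v by (force simp: alphabet_def)
    then obtain w where "w \<in> group_words X" "m * length w + 1 \<le> N" "ev w = fst (y h) (v, b)"
      using short by blast
    then show ?thesis using integral_map_letter[OF h v] by auto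
  qed
qed (use F N_ge integral_map_closed integral_map_lift short in auto)

text \<open>Global injectivity enters twice: it makes the local pieces of \<open>y\<close>
  compatible, so that they glue to a point of \<open>\<Xi>\<close>, and it confines the powers of
  \<open>h\<close> to a finite ball.\<close>

lemma stabilizer_trivial:
  assumes aperiodic: "\<And>x g. \<lbrakk>x \<in> \<Xi>; g \<in> carrier G; shift G x g = x\<rbrakk> \<Longrightarrow> g = \<one>\<^bsub>G\<^esub>"
    and torsion_free: "torsion_free_group H"
    and h: "h \<in> carrier H" and stab: "\<And>k. k \<in> carrier H \<Longrightarrow> y (h \<otimes>\<^bsub>H\<^esub> k) = y k"
  shows "h = \<one>\<^bsub>H\<^esub>"
proof -
  interpret C: coarse_covering H Y Q evH G X R ev integral_map F m N
    by (rule coarse_covering_integral_map)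
  let ?\<phi> = integral_map
  have FG: "a \<in> carrier G" if "a \<in> F" for a using that F by blast
  \<comment> \<open>Two descriptions of the same point of \<open>G\<close> come from places within
    \<open>m\<close> of each other, hence from one ball, on which a single element of
    \<open>\<Xi>\<close> accounts for both symbols.\<close>
  have consistent: "snd (y k) a = snd (y k') a'"
    if k: "k \<in> carrier H" "k' \<in> carrier H" and a: "a \<in> F" "a' \<in> F"
      and eq: "?\<phi> k \<otimes>\<^bsub>G\<^esub> a = ?\<phi> k' \<otimes>\<^bsub>G\<^esub> a'" for k k' a a'
  proof -
    obtain x where x: "\<And>u a. u \<in> H.wball N \<Longrightarrow> a \<in> F
        \<Longrightarrow> snd (y (k \<otimes>\<^bsub>H\<^esub> u)) a = x (?\<phi> (k \<otimes>\<^bsub>H\<^esub> u) \<otimes>\<^bsub>G\<^esub> a)"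
      using integral_map_local[OF k(1)] by metis
    have "inv\<^bsub>H\<^esub> k \<otimes>\<^bsub>H\<^esub> k' \<in> H.wball m" using C.globally_injective[OF k a eq] .
    then have "inv\<^bsub>H\<^esub> k \<otimes>\<^bsub>H\<^esub> k' \<in> H.wball N" using N_ge(1) H.wball_mono by simp
    from x[OF this a(2)] x[of "\<one>\<^bsub>H\<^esub>", OF _ a(1)] show ?thesis
      using k eq by (simp add: H.mult_inv_cancel)
  qed
  \<comment> \<open>The pair is chosen arbitrarily among the descriptions of \<open>g\<close>; one
    exists by \<open>globally_surjective\<close>, and \<open>consistent\<close> makes the value
    independent of it.\<close>
  define x where "x = (\<lambda>g\<in>carrier G. let p = SOME p. p \<in> carrier H \<times> F \<and> g = ?\<phi> (fst p) \<otimes>\<^bsub>G\<^esub> snd p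
    in snd (y (fst p)) (snd p))"
  have x: "x (?\<phi> k \<otimes>\<^bsub>G\<^esub> a) = snd (y k) a" if k: "k \<in> carrier H" and a: "a \<in> F" for k a
  proof -
    let ?g = "?\<phi> k \<otimes>\<^bsub>G\<^esub> a"
    let ?P = "\<lambda>p. p \<in> carrier H \<times> F \<and> ?g = ?\<phi> (fst p) \<otimes>\<^bsub>G\<^esub> snd p"
    define p where "p = (SOME p. ?P p)"
    have "?P (k, a)" using k a by simp
    then have p: "?P p" unfolding p_def by (rule someI)
    have "x ?g = snd (y (fst p)) (snd p)"
      unfolding x_def p_def using k a FG by (simp add: Let_def)
    also have "\<dots> = snd (y k) a" using p k a by (intro consistent) auto
    finally show ?thesis .
  qed
  have "x \<in> \<Xi>"
    unfolding \<Xi> mem_Collect_eq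
  proof (intro conjI ballI)
    have "x g \<in> A" if g: "g \<in> carrier G" for g
    proof -
      obtain k a where k: "k \<in> carrier H" "a \<in> F" "g = ?\<phi> k \<otimes>\<^bsub>G\<^esub> a"
        using C.globally_surjective[OF g] by blast
      moreover have "snd (y k) a \<in> A" using y k by (force simp: alphabet_def)
      ultimately show ?thesis by (simp add: x)
    qed
    then show "x \<in> carrier G \<rightarrow>\<^sub>E A" by (auto simp: x_def)
    fix g assume g: "g \<in> carrier G"
    obtain k a where k: "k \<in> carrier H" "a \<in> F" "g = ?\<phi> k \<otimes>\<^bsub>G\<^esub> a"
      using C.globally_surjective[OF g] by blast
    obtain x' where x': "x' \<in> \<Xi>" "\<And>u a. u \<in> H.wball N \<Longrightarrow> a \<in> F
        \<Longrightarrow> snd (y (k \<otimes>\<^bsub>H\<^esub> u)) a = x' (?\<phi> (k \<otimes>\<^bsub>H\<^esub> u) \<otimes>\<^bsub>G\<^esub> a)"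
      using integral_map_local[OF k(1)] by metis
    \<comment> \<open>Steps in \<open>S\<close> from \<open>g\<close> lift to places within
      \<open>m \<le> N\<close> of \<open>k\<close>, so the pattern of \<open>x\<close> at
      \<open>g\<close> is that of the local model \<open>x'\<close>.\<close>
    have "shift G x g s = shift G x' g s" if s: "s \<in> S" for s
    proof -
      have sG: "s \<in> carrier G" using s S by blast
      obtain u a' where u: "u \<in> H.wball m" "a' \<in> F" "g \<otimes>\<^bsub>G\<^esub> s = ?\<phi> (k \<otimes>\<^bsub>H\<^esub> u) \<otimes>\<^bsub>G\<^esub> a'"
        using integral_map_lift[OF k(1,2), of s] s k(3) by blast
      then have "u \<in> H.wball N" using N_ge(1) H.wball_mono by simp
      then show ?thesis
        using x'(2)[of u a'] x[of "k \<otimes>\<^bsub>H\<^esub> u" a'] u k sG by (simp add: G.shift_apply)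
    qed
    then have "restrict (shift G x g) S = restrict (shift G x' g) S" by (rule restrict_ext)
    then show "restrict (shift G x g) S \<in> L" using x'(1) g by (simp add: \<Xi>)
  qed
  \<comment> \<open>As functions of \<open>k\<close> both sides agree at \<open>\<one>\<close> and
    have the same increments, because \<open>y\<close> is invariant under \<open>h\<close>.\<close>
  have mult: "?\<phi> (h \<otimes>\<^bsub>H\<^esub> k) = ?\<phi> h \<otimes>\<^bsub>G\<^esub> ?\<phi> k" if "k \<in> carrier H" for k
  proof -
    have "?\<phi> (h \<otimes>\<^bsub>H\<^esub> evH w) = ?\<phi> h \<otimes>\<^bsub>G\<^esub> ?\<phi> (evH w)" if "w \<in> group_words Y" for w
      using that
    proof (induction w rule: rev_induct)
      case Nil
      then show ?case using h by (simp add: integral_map_one integral_map_closed)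
    next
      case (snoc l w)
      obtain v b where l: "l = (v, b)" by fastforce
      have w: "w \<in> group_words Y" "v \<in> Y" using snoc by (auto simp: l)
      then show ?case
        using snoc.IH integral_map_letter[of "h \<otimes>\<^bsub>H\<^esub> evH w" v b] integral_map_letter[of "evH w" v b]
          h stab[of "evH w"] derivative_closed[of "evH w" v b]
        by (simp add: l H.ev_append H.m_assoc G.m_assoc integral_map_closed)
    qed
    then show ?thesis using H.ev_surj that by blast
  qed
  \<comment> \<open>Replacing \<open>k\<close> by \<open>h \<otimes> k\<close> moves the point by
    \<open>integral_map h\<close> on the left and leaves its symbol unchanged.\<close>
  have "shift G x (?\<phi> h) = x"
  proof
    fix g
    show "shift G x (?\<phi> h) g = x g"
    proof (cases "g \<in> carrier G")
      case True
      then obtain k a where k: "k \<in> carrier H" "a \<in> F" "g = ?\<phi> k \<otimes>\<^bsub>G\<^esub> a"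
        using C.globally_surjective by blast
      then have "?\<phi> h \<otimes>\<^bsub>G\<^esub> g = ?\<phi> (h \<otimes>\<^bsub>H\<^esub> k) \<otimes>\<^bsub>G\<^esub> a"
        using h FG by (simp add: mult G.m_assoc integral_map_closed)
      then show ?thesis using True k h x stab by (simp add: G.shift_apply)
    qed (simp add: shift_def x_def)
  qed
  then have \<phi>h: "?\<phi> h = \<one>\<^bsub>G\<^esub>" using aperiodic \<open>x \<in> \<Xi>\<close> h integral_map_closed by blast
  \<comment> \<open>All powers of \<open>h\<close> lie over \<open>\<one>\<close>, so injectivity
    puts them within \<open>m\<close> of the identity.\<close>
  have pow: "h [^]\<^bsub>H\<^esub> n \<in> H.wball m" for n :: nat
  proof -
    have "?\<phi> (h [^]\<^bsub>H\<^esub> n) = \<one>\<^bsub>G\<^esub>"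
    proof (induction n)
      case 0
      then show ?case by (simp add: integral_map_one)
    next
      case (Suc n)
      then show ?case
        unfolding H.nat_pow_Suc2[OF h] using mult[of "h [^]\<^bsub>H\<^esub> n"] h \<phi>h by simp
    qed
    then show ?thesis
      using C.globally_injective[of "\<one>\<^bsub>H\<^esub>" "h [^]\<^bsub>H\<^esub> n" "\<one>\<^bsub>G\<^esub>" "\<one>\<^bsub>G\<^esub>"] h F integral_map_one by simp
  qed
  then have "range (\<lambda>n::nat. h [^]\<^bsub>H\<^esub> n) \<subseteq> H.wball m" by auto
  then have "finite (range (\<lambda>n::nat. h [^]\<^bsub>H\<^esub> n))"
    using H.finite_wball by (rule finite_subset)
  then have "\<not> inj (\<lambda>n::nat. h [^]\<^bsub>H\<^esub> n)" using range_inj_infinite by blast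
  then obtain i j :: nat where "i \<noteq> j" "h [^]\<^bsub>H\<^esub> i = h [^]\<^bsub>H\<^esub> j" by (auto simp: inj_on_def)
  then obtain i j :: nat where ij: "i < j" "h [^]\<^bsub>H\<^esub> j = h [^]\<^bsub>H\<^esub> i" by (metis linorder_neqE_nat)
  then have "h [^]\<^bsub>H\<^esub> (j - i) = \<one>\<^bsub>H\<^esub>" using H.pow_eq_div2 h by blast
  moreover have "0 < j - i" using ij(1) by simp
  ultimately show ?thesis using torsion_free h unfolding torsion_free_group_def by blast
qed

end

text \<open>Any \<open>x\<close> in \<open>\<Xi>\<close> yields the configuration
  \<open>symbol x\<close>, which obeys the rule everywhere; this gives nonemptiness, and
  \<open>stabilizer_trivial\<close> gives aperiodicity.\<close>

lemma admits_strongly_aperiodic_SFT_pullback: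
  assumes "\<Xi> \<noteq> {}"
    and aperiodic: "\<And>x g. \<lbrakk>x \<in> \<Xi>; g \<in> carrier G; shift G x g = x\<rbrakk> \<Longrightarrow> g = \<one>\<^bsub>G\<^esub>"
    and torsion_free: "torsion_free_group H"
  shows "admits_strongly_aperiodic_SFT H"
proof -
  obtain x where x: "x \<in> \<Xi>" using assms by blast
  show ?thesis
  proof (rule H.admits_strongly_aperiodic_SFT_local_rule[OF finite_alphabet H.finite_wball])
    show "pullback_rule y'" if "\<And>d. d \<in> H.wball N \<Longrightarrow> y d = y' d" "pullback_rule y" for y y'
      using that unfolding pullback_rule_def by metis
    show "symbol x \<in> carrier H \<rightarrow> alphabet" using symbol_in_alphabet[OF x] by blast
    show "pullback_rule (\<lambda>k. symbol x (g \<otimes>\<^bsub>H\<^esub> k))" if "g \<in> carrier H" for g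
      using pullback_rule_symbol[OF x that] .
    show "h = \<one>\<^bsub>H\<^esub>" if "y \<in> carrier H \<rightarrow> alphabet"
      "\<And>g. g \<in> carrier H \<Longrightarrow> pullback_rule (\<lambda>k. y (g \<otimes>\<^bsub>H\<^esub> k))" "h \<in> carrier H"
      "\<And>k. k \<in> carrier H \<Longrightarrow> y (h \<otimes>\<^bsub>H\<^esub> k) = y k" for y h
      by (rule stabilizer_trivial[of y h]) (fact that aperiodic torsion_free)+
  qed auto
qed

end

text \<open>What remains is the choice of constants: \<open>F\<close> comes from coarse
  surjectivity, \<open>m\<close> from properness, \<open>V\<close> from control, and
  \<open>N\<close> is then taken large.\<close>

lemma coarse_equivalence_admits_strongly_aperiodic_SFT:
  assumes "group G" "group H" "torsion_free_group H" "finitely_presented G" "finitely_presented H"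
    and equiv: "coarse_equivalence H G \<phi>" and "admits_strongly_aperiodic_SFT G"
  shows "admits_strongly_aperiodic_SFT H"
proof -
  obtain X :: "nat set" and R ev where "group_presentation G X R ev"
    using finitely_presented_presentation assms by blast
  then interpret G: group_presentation G X R ev .
  obtain Y :: "nat set" and Q evH where "group_presentation H Y Q evH"
    using finitely_presented_presentation assms by blast
  then interpret H: group_presentation H Y Q evH .
  obtain A :: "nat set" and \<Xi> where A: "finite A" "subshift_of_finite_type G A \<Xi>" "strongly_aperiodic G A \<Xi>"
    using assms(7) by (auto simp: admits_strongly_aperiodic_SFT_def)
  obtain S L where S: "finite S" "S \<subseteq> carrier G"
    and \<Xi>: "\<Xi> = {\<sigma> \<in> carrier G \<rightarrow>\<^sub>E A. \<forall>g\<in>carrier G. restrict (shift G \<sigma> g) S \<in> L}"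
    using A(2) unfolding subshift_of_finite_type_def G.SFT_eq by (elim exE conjE)
  have \<phi>: "\<phi> h \<in> carrier G" if "h \<in> carrier H" for h
    using equiv that by (auto simp: coarse_equivalence_def)
  have ctrl: "\<And>F. finite F \<Longrightarrow> F \<subseteq> carrier H \<Longrightarrow> \<exists>F'. finite F' \<and> F' \<subseteq> carrier G \<and>
        (\<forall>h\<in>carrier H. \<forall>h'\<in>carrier H. inv\<^bsub>H\<^esub> h \<otimes>\<^bsub>H\<^esub> h' \<in> F \<longrightarrow> inv\<^bsub>G\<^esub> (\<phi> h) \<otimes>\<^bsub>G\<^esub> \<phi> h' \<in> F')"
    and proper: "\<And>F. finite F \<Longrightarrow> F \<subseteq> carrier G \<Longrightarrow> \<exists>F'. finite F' \<and> F' \<subseteq> carrier H \<and>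
        (\<forall>h\<in>carrier H. \<forall>h'\<in>carrier H. inv\<^bsub>G\<^esub> (\<phi> h) \<otimes>\<^bsub>G\<^esub> \<phi> h' \<in> F \<longrightarrow> inv\<^bsub>H\<^esub> h \<otimes>\<^bsub>H\<^esub> h' \<in> F')"
    using equiv unfolding coarse_equivalence_def by blast+
  have "\<exists>F. finite F \<and> F \<subseteq> carrier G \<and> (\<forall>g\<in>carrier G. \<exists>h\<in>carrier H. inv\<^bsub>G\<^esub> (\<phi> h) \<otimes>\<^bsub>G\<^esub> g \<in> F)"
    using equiv unfolding coarse_equivalence_def by (elim conjE)
  then obtain F0 where F0: "finite F0" "F0 \<subseteq> carrier G"
    and surj: "\<forall>g\<in>carrier G. \<exists>h\<in>carrier H. inv\<^bsub>G\<^esub> (\<phi> h) \<otimes>\<^bsub>G\<^esub> g \<in> F0"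
    by (elim exE conjE)
  define F where "F = insert \<one>\<^bsub>G\<^esub> F0"
  have F: "finite F" "F \<subseteq> carrier G" "\<one>\<^bsub>G\<^esub> \<in> F" using F0 by (auto simp: F_def)
  have onto: "\<exists>h\<in>carrier H. \<exists>a\<in>F. g = \<phi> h \<otimes>\<^bsub>G\<^esub> a" if g: "g \<in> carrier G" for g
  proof -
    obtain h where "h \<in> carrier H" "inv\<^bsub>G\<^esub> (\<phi> h) \<otimes>\<^bsub>G\<^esub> g \<in> F" using surj g by (auto simp: F_def)
    moreover have "g = \<phi> h \<otimes>\<^bsub>G\<^esub> (inv\<^bsub>G\<^esub> (\<phi> h) \<otimes>\<^bsub>G\<^esub> g)"
      using \<phi> g \<open>h \<in> carrier H\<close> by (simp add: G.mult_inv_cancel)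
    ultimately show ?thesis by blast
  qed
  define W where "W = insert \<one>\<^bsub>G\<^esub> (S \<union> (\<lambda>l. ev [l]) ` (X \<times> UNIV))"
  have W: "finite W" "W \<subseteq> carrier G" using S G.finite_generators by (auto simp: W_def)
  \<comment> \<open>These are the differences of \<open>\<phi> k\<close> and
    \<open>\<phi> k'\<close> that an equation
    \<open>\<phi> k \<otimes> a \<otimes> s = \<phi> k' \<otimes> a'\<close> permits.\<close>
  let ?K = "(\<lambda>(a, s, a'). a \<otimes>\<^bsub>G\<^esub> s \<otimes>\<^bsub>G\<^esub> inv\<^bsub>G\<^esub> a') ` (F \<times> W \<times> F)"
  have K: "finite ?K" "?K \<subseteq> carrier G" using F W by (auto simp: subset_iff)
  obtain K' where K': "finite K'" "K' \<subseteq> carrier H" "\<forall>h\<in>carrier H. \<forall>h'\<in>carrier H.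
      inv\<^bsub>G\<^esub> (\<phi> h) \<otimes>\<^bsub>G\<^esub> \<phi> h' \<in> ?K \<longrightarrow> inv\<^bsub>H\<^esub> h \<otimes>\<^bsub>H\<^esub> h' \<in> K'"
    using proper[OF K] by (elim exE conjE)
  obtain m where m: "K' \<subseteq> H.wball m" using H.finite_subset_wball[OF K'(1,2)] by blast
  have close: "inv\<^bsub>H\<^esub> k \<otimes>\<^bsub>H\<^esub> k' \<in> H.wball m"
    if k: "k \<in> carrier H" "k' \<in> carrier H" and a: "a \<in> F" "a' \<in> F" and s: "s \<in> W"
      and eq: "\<phi> k \<otimes>\<^bsub>G\<^esub> a \<otimes>\<^bsub>G\<^esub> s = \<phi> k' \<otimes>\<^bsub>G\<^esub> a'" for k k' a a' s
  proof -
    have carr: "a \<in> carrier G" "a' \<in> carrier G" "s \<in> carrier G" "\<phi> k \<in> carrier G" "\<phi> k' \<in> carrier G"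
      using a s k F W \<phi> by auto
    have "\<phi> k' = \<phi> k \<otimes>\<^bsub>G\<^esub> a \<otimes>\<^bsub>G\<^esub> s \<otimes>\<^bsub>G\<^esub> inv\<^bsub>G\<^esub> a'" using carr by (simp add: eq G.m_assoc)
    then have "inv\<^bsub>G\<^esub> (\<phi> k) \<otimes>\<^bsub>G\<^esub> \<phi> k' = a \<otimes>\<^bsub>G\<^esub> s \<otimes>\<^bsub>G\<^esub> inv\<^bsub>G\<^esub> a'"
      using carr by (simp add: G.m_assoc G.inv_mult_cancel)
    then have "inv\<^bsub>G\<^esub> (\<phi> k) \<otimes>\<^bsub>G\<^esub> \<phi> k' \<in> ?K" using a s by force
    then show ?thesis using K'(3) k m by blast
  qed
  \<comment> \<open>Control applied to the letters of \<open>H\<close> confines all increments of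
    \<open>\<phi>\<close> to the finite set \<open>V\<close>.\<close>
  let ?E = "(\<lambda>l. evH [l]) ` (Y \<times> UNIV)"
  have E: "finite ?E" "?E \<subseteq> carrier H" using H.finite_generators by auto
  obtain V where V: "finite V" "V \<subseteq> carrier G" "\<forall>h\<in>carrier H. \<forall>h'\<in>carrier H.
      inv\<^bsub>H\<^esub> h \<otimes>\<^bsub>H\<^esub> h' \<in> ?E \<longrightarrow> inv\<^bsub>G\<^esub> (\<phi> h) \<otimes>\<^bsub>G\<^esub> \<phi> h' \<in> V"
    using ctrl[OF E] by (elim exE conjE)
  have deriv: "inv\<^bsub>G\<^esub> (\<phi> h) \<otimes>\<^bsub>G\<^esub> \<phi> (h \<otimes>\<^bsub>H\<^esub> evH [(v, b)]) \<in> V"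
    if "h \<in> carrier H" "v \<in> Y" for h v b
  proof -
    have "inv\<^bsub>H\<^esub> h \<otimes>\<^bsub>H\<^esub> (h \<otimes>\<^bsub>H\<^esub> evH [(v, b)]) \<in> ?E" using that by (simp add: H.inv_mult_cancel)
    then show ?thesis using V(3) that by simp
  qed
  have "finite (V \<union> F)" "V \<union> F \<subseteq> carrier G" using V F by auto
  then obtain M where M: "V \<union> F \<subseteq> G.wball M" using G.finite_subset_wball by blast
  \<comment> \<open>Each summand meets one of the size requirements. The total length of the
    relators stands in for the maximum, and the 2 leaves room for cancelling pairs and for the
    \<open>+ 1\<close> in \<open>short\<close>.\<close>
  define N where "N = 3 * m + 2 + m * (M + sum length R) + sum length Q"
  have R: "length r \<le> sum length R" if "r \<in> R" for r
    using member_le_sum[of r R length] that G.finite_relators by simp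
  have Q: "length q \<le> sum length Q" if "q \<in> Q" for q
    using member_le_sum[of q Q length] that H.finite_relators by simp
  have "SFT_pullback H Y Q evH G X R ev \<phi> F V S m N A L \<Xi>"
  proof unfold_locales
    show "m * length r \<le> N" if "r \<in> R" for r
      using mult_le_mono2[OF R[OF that], of m] unfolding N_def distrib_left by linarith
    show "length q \<le> N" if "q \<in> Q" for q using Q[OF that] by (simp add: N_def)
    show "\<exists>w\<in>group_words X. m * length w + 1 \<le> N \<and> ev w = v" if v: "v \<in> V \<union> F" for v
    proof -
      obtain w where w: "w \<in> group_words X" "length w \<le> M" "ev w = v"
        using M v by (auto simp: G.wball_def)
      have "m * length w + 1 \<le> N"
        using mult_le_mono2[OF w(2), of m] unfolding N_def distrib_left by linarith
      then show ?thesis using w by blast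
    qed
    show "inv\<^bsub>H\<^esub> k \<otimes>\<^bsub>H\<^esub> k' \<in> H.wball m"
      if "k \<in> carrier H" "k' \<in> carrier H" "a \<in> F" "a' \<in> F"
        "s \<in> insert \<one>\<^bsub>G\<^esub> (S \<union> (\<lambda>l. ev [l]) ` (X \<times> UNIV))"
        "\<phi> k \<otimes>\<^bsub>G\<^esub> a \<otimes>\<^bsub>G\<^esub> s = \<phi> k' \<otimes>\<^bsub>G\<^esub> a'" for k k' a a' s
      using close that unfolding W_def by blast
  qed (use \<phi> F onto V deriv S A \<Xi> in \<open>simp_all add: N_def\<close>)
  then interpret P: SFT_pullback H Y Q evH G X R ev \<phi> F V S m N A L \<Xi> .
  have "\<Xi> \<noteq> {}" and "\<And>x g. \<lbrakk>x \<in> \<Xi>; g \<in> carrier G; shift G x g = x\<rbrakk> \<Longrightarrow> g = \<one>\<^bsub>G\<^esub>"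
    using A(3) unfolding strongly_aperiodic_def by blast+
  then show ?thesis using P.admits_strongly_aperiodic_SFT_pullback assms(3) by blast
qed

theorem theorem1p10:
  fixes G :: "('a, 'c) monoid_scheme" and H :: "('b, 'd) monoid_scheme"
  assumes "group G" and "group H"
    and "torsion_free_group G" and "torsion_free_group H"
    and "finitely_presented G" and "finitely_presented H"
    and "quasi_isometric_groups G H"
  shows "admits_strongly_aperiodic_SFT G \<longleftrightarrow> admits_strongly_aperiodic_SFT H"
proof -
  obtain \<phi> where \<phi>: "coarse_equivalence G H \<phi>"
    using quasi_isometric_groups_coarse_equivalence assms by blast
  \<comment> \<open>A subshift is carried from the target of a coarse equivalence to its source, so
    the two implications need maps in opposite directions.\<close>
  obtain \<psi> where \<psi>: "coarse_equivalence H G \<psi>"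
    using coarse_equivalence_sym[OF assms(1,2) \<phi>] by blast
  show ?thesis
    using coarse_equivalence_admits_strongly_aperiodic_SFT[OF _ _ _ _ _ \<phi>]
      coarse_equivalence_admits_strongly_aperiodic_SFT[OF _ _ _ _ _ \<psi>] assms by blast
qed

end
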